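(* Let $(X,\mathcal{B},\mu)$ be a $\sigma$-finite measure space and let $T:X\to X$ be a conservative, measure preserving transformation. Let $(a_n)_{n\geq 1}$ be a sub-additive sequence (with respect to $T$) of measurable functions on $X$ with values in $[-\infty,+\infty]$, and with $(a_1)^+\in L^1(X,\mu)$. Let $g\in L^1(X,\mu)$ with $g>0$ $\mu$-almost everywhere. Then the limit $$h:=\lim_{n\to+\infty}\frac{a_n}{S_n g}\in[-\infty,+\infty)$$ exists $\mu$-almost everywhere. If $A\in\mathcal{B}$ is a $T$-invariant set, then $$\inf_{n\geq 1}\frac1n\int_A a_n\,d\mu=\lim_{n\to+\infty}\frac1n\int_A a_n\,d\mu=\int_A h\,g\,d\mu\in[-\infty,+\infty).$$
   Context: A measure preserving transformation $T$ of $(X,\mathcal{B},\mu)$ is conservative if for every $A\in\mathcal{B}$ with $\mu(A)>0$ there exists $n\geq 1$ such that $\mu(A\cap T^{-n}A)>0$. Ergodicity is not assumed. A subset $A\subset X$ is $T$-invariant if $T^{-1}A=A$. For $g:X\to\mathbb{R}$, $S_n g:=\sum_{k=0}^{n-1} g\circ T^k$. A sequence $(a_n)_{n\geq 1}$ of measurable functions is sub-additive (with respect to $T$) if for all $n,m\geq 1$, $a_{n+m}\leq a_n+a_m\circ T^n$ $\mu$-almost everywhere. Here $(a_1)^+=\max\{a_1,0\}$. Integrals are those of extended-real-valued functions whose positive part is integrable, so they take values in $[-\infty,+\infty)$. *)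

theory Defs
  imports "HOL-Analysis.Analysis"
begin

definition measure_preserving_map :: "'a measure \<Rightarrow> ('a \<Rightarrow> 'a) \<Rightarrow> bool" where
  "measure_preserving_map M T \<longleftrightarrow>
     T \<in> M \<rightarrow>\<^sub>M M \<and> (\<forall>A\<in>sets M. emeasure M (T -` A \<inter> space M) = emeasure M A)"

definition conservative_map :: "'a measure \<Rightarrow> ('a \<Rightarrow> 'a) \<Rightarrow> bool" where
  "conservative_map M T \<longleftrightarrow>
     (\<forall>A\<in>sets M. emeasure M A > 0 \<longrightarrow> (\<exists>n\<ge>1. emeasure M (A \<inter> (T ^^ n) -` A) > 0))"

definition invariant_set :: "'a measure \<Rightarrow> ('a \<Rightarrow> 'a) \<Rightarrow> 'a set \<Rightarrow> bool" where
  "invariant_set M T A \<longleftrightarrow> A \<subseteq> space M \<and> T -` A \<inter> space M = A"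

definition birkhoff_sum :: "('a \<Rightarrow> 'a) \<Rightarrow> ('a \<Rightarrow> real) \<Rightarrow> nat \<Rightarrow> 'a \<Rightarrow> real" where
  "birkhoff_sum T g n x = (\<Sum>k<n. g ((T ^^ k) x))"

text \<open>Sequences start at index 1; the value of \<open>a\<close> at index 0 is irrelevant.
  In \<^typ>\<open>ereal\<close> the sum of infinities of opposite sign is \<open>\<infinity>\<close>. If the positive part of
  \<open>a 1\<close> is integrable and \<open>T\<close> preserves the measure, this convention only
  matters on null sets, since then every \<open>a n\<close> with \<open>n \<ge> 1\<close> is below \<open>\<infinity>\<close> almost everywhere.\<close>

definition subadditive_seq ::
    "'a measure \<Rightarrow> ('a \<Rightarrow> 'a) \<Rightarrow> (nat \<Rightarrow> 'a \<Rightarrow> ereal) \<Rightarrow> bool" where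
  "subadditive_seq M T a \<longleftrightarrow>
     (\<forall>n\<ge>1. \<forall>m\<ge>1. AE x in M. a (n + m) x \<le> a n x + a m ((T ^^ n) x))"

definition pos_part_integrable :: "'a measure \<Rightarrow> ('a \<Rightarrow> ereal) \<Rightarrow> bool" where
  "pos_part_integrable M f \<longleftrightarrow>
     f \<in> borel_measurable M \<and> (\<integral>\<^sup>+x. e2ennreal (max (f x) 0) \<partial>M) < \<infinity>"

text \<open>The integral, with values in \<open>[-\<infinity>, \<infinity>)\<close>, of an extended-real function whose positive part
  is integrable; it is only meaningful together with \<^const>\<open>pos_part_integrable\<close>.\<close>

definition ereal_integral :: "'a measure \<Rightarrow> ('a \<Rightarrow> ereal) \<Rightarrow> ereal" where
  "ereal_integral M f =
     enn2ereal (\<integral>\<^sup>+x. e2ennreal (max (f x) 0) \<partial>M)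
     - enn2ereal (\<integral>\<^sup>+x. e2ennreal (max (- f x) 0) \<partial>M)"

text \<open>Restriction to a set is multiplication by the indicator, which is harmless for infinite
  values because \<open>0 * \<infinity> = 0\<close> in \<^typ>\<open>ereal\<close>.\<close>

definition set_pos_part_integrable :: "'a measure \<Rightarrow> 'a set \<Rightarrow> ('a \<Rightarrow> ereal) \<Rightarrow> bool" where
  "set_pos_part_integrable M A f \<longleftrightarrow> pos_part_integrable M (\<lambda>x. indicator A x * f x)"

definition ereal_set_integral :: "'a measure \<Rightarrow> 'a set \<Rightarrow> ('a \<Rightarrow> ereal) \<Rightarrow> ereal" where
  "ereal_set_integral M A f = ereal_integral M (\<lambda>x. indicator A x * f x)"

end

theory Submission
  imports Defs
begin

text \<open>Write \<open>G n\<close> for the \<open>n\<close>-th Birkhoff sum of the weight \<open>g\<close>. The theorem is a ratio version of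
Kingman's subadditive ergodic theorem. Although the measure may be infinite, all the
smallness in the proof is measured by integrals against the finite measure of density \<open>g\<close>
or by integrals of integrable functions, so the covering proof known for probability measures
carries over, once two facts about the growth of \<open>G n\<close> are available.

The first is that \<open>G n\<close> tends to infinity almost everywhere, which is what conservativity gives
(\<open>weight_diverges\<close>). The second is that \<open>v \<circ> T ^^ n\<close> is negligible against \<open>G n\<close> for integrable
\<open>v\<close> (\<open>iterate_over_weight_tendsto_0\<close>).

Let \<open>b\<close> be a real-valued subadditive sequence and \<open>V\<close> the lower limit of \<open>b n / G n\<close>. Then \<open>V\<close>
does not decrease along orbits. Almost every point starts a block of some length \<open>n\<close> on which
\<open>b n\<close> is at most \<open>(V + e) * G n\<close>; covering long orbits by such blocks (\<open>orbit_covering\<close>)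
and integrating shows that the upper limit of \<open>(\<integral>x. b n x \<partial>M) / n\<close> is at most
\<open>\<integral>x. V x * g x \<partial>M\<close> (\<open>eventually_mean_le_integral_liminf\<close>, where \<open>V\<close> is cut off below).

For the additive sequences \<open>birkhoff_sum T f\<close> and its negative this estimate bounds the integral
of \<open>f\<close> from above by the weighted integral of the lower limit of the ratios and from below by
that of the upper limit, so the two limits agree: this is Hopf's theorem (\<open>ratio_ergodic\<close>).
For a subadditive sequence with \<open>- L * G n \<le> b n\<close>, comparing
\<open>b n\<close> with the Birkhoff sums of \<open>b m\<close> bounds the upper limit of the ratios by \<open>1 / m\<close> times the
Hopf limit for \<open>b m\<close>, so the weighted integral of the upper limit is at most every mean
\<open>(\<integral>x. b m x \<partial>M) / m\<close>. Together with the covering estimate, the upper and lower limits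
agree and the means converge to their infimum (\<open>subadditive_ratio_bounded_below\<close>).

The general case follows by applying this to the maximum of \<open>a n\<close> and \<open>- L * G n\<close> and letting
\<open>L\<close> tend to infinity (\<open>subadditive_ratio\<close>). An invariant set \<open>A\<close> is handled by passing from \<open>a\<close>
to its product with the indicator of \<open>A\<close>, which is again subadditive.\<close>

section \<open>Birkhoff sums along a measure preserving map\<close>

lemma birkhoff_sum_0 [simp]: "birkhoff_sum T f 0 x = 0"
  by (simp add: birkhoff_sum_def)

lemma birkhoff_sum_add:
  "birkhoff_sum T f (n + m) x = birkhoff_sum T f n x + birkhoff_sum T f m ((T ^^ n) x)"
proof (induction m)
  case (Suc m)
  have "(T ^^ (n + m)) x = (T ^^ m) ((T ^^ n) x)"
    by (metis add.commute comp_apply funpow_add)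
  with Suc show ?case
    by (simp add: birkhoff_sum_def)
qed simp

lemma birkhoff_sum_Suc: "birkhoff_sum T f (Suc n) x = f x + birkhoff_sum T f n (T x)"
  using birkhoff_sum_add[of T f 1 n x] by (simp add: birkhoff_sum_def)

lemma birkhoff_sum_nonneg: "(\<And>x. 0 \<le> f x) \<Longrightarrow> 0 \<le> birkhoff_sum T f n x"
  by (auto simp: birkhoff_sum_def intro!: sum_nonneg)

locale measure_preserving =
  fixes M :: "'a measure" and T :: "'a \<Rightarrow> 'a"
  assumes preserving: "measure_preserving_map M T"
begin

lemma measurable_T [measurable]: "T \<in> M \<rightarrow>\<^sub>M M"
  using preserving by (simp add: measure_preserving_map_def)

lemma measurable_iterate [measurable]: "(T ^^ k) \<in> M \<rightarrow>\<^sub>M M"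
  by (induction k) auto

lemma distr_T: "distr M M T = M"
proof (rule measure_eqI)
  fix A assume "A \<in> sets (distr M M T)"
  then show "emeasure (distr M M T) A = emeasure M A"
    using preserving by (simp add: measure_preserving_map_def emeasure_distr)
qed simp

lemma distr_iterate: "distr M M (T ^^ k) = M"
proof (induction k)
  case 0
  show ?case by (simp add: distr_id2)
next
  case (Suc k)
  have "distr M M (T ^^ Suc k) = distr (distr M M (T ^^ k)) M T"
    by (simp add: distr_distr)
  then show ?case by (simp only: Suc distr_T)
qed

lemma AE_orbit:
  assumes "AE x in M. P x"
  shows "AE x in M. \<forall>k. P ((T ^^ k) x)"
proof -
  have "AE x in M. P ((T ^^ k) x)" for k
    using assms by (intro AE_distrD[of "T ^^ k" M M]) (simp, unfold distr_iterate)
  then show ?thesis by (simp add: AE_all_countable)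
qed

lemma integrable_iterate:
  fixes f :: "'a \<Rightarrow> real"
  assumes "integrable M f"
  shows "integrable M (\<lambda>x. f ((T ^^ k) x))"
  using assms by (intro integrable_distr[of "T ^^ k" M M]) (simp, unfold distr_iterate)

lemma integral_iterate:
  fixes f :: "'a \<Rightarrow> real"
  assumes [measurable]: "f \<in> borel_measurable M"
  shows "(\<integral>x. f ((T ^^ k) x) \<partial>M) = (\<integral>x. f x \<partial>M)"
  using integral_distr[of "T ^^ k" M M f, unfolded distr_iterate] by simp

lemma measurable_birkhoff_sum [measurable]:
  assumes [measurable]: "f \<in> borel_measurable M"
  shows "birkhoff_sum T f n \<in> borel_measurable M"
  unfolding birkhoff_sum_def[abs_def] by measurable

lemma integrable_birkhoff_sum:
  assumes "integrable M f"
  shows "integrable M (birkhoff_sum T f n)"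
  unfolding birkhoff_sum_def[abs_def] using assms by (intro Bochner_Integration.integrable_sum integrable_iterate)

lemma integral_birkhoff_sum:
  assumes "integrable M f"
  shows "(\<integral>x. birkhoff_sum T f n x \<partial>M) = real n * (\<integral>x. f x \<partial>M)"
  unfolding birkhoff_sum_def[abs_def] using assms
  by (subst Bochner_Integration.integral_sum) (simp_all add: integrable_iterate integral_iterate)

end

section \<open>Divergence and slow growth of the weight sums\<close>

text \<open>The weight \<open>g\<close> is positive at every point, not only almost everywhere, so that the
ratios below are honest quotients for \<open>n \<ge> 1\<close>. Through \<open>g\<close> the possibly infinite
measure is replaced by the finite measure of density \<open>g\<close>.\<close>

locale conservative_weighted = measure_preserving M T
  for M :: "'a measure" and T :: "'a \<Rightarrow> 'a" +
  fixes g :: "'a \<Rightarrow> real"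
  assumes conservative: "conservative_map M T"
    and integrable_weight: "integrable M g"
    and weight_pos: "g x > 0"
begin

abbreviation G :: "nat \<Rightarrow> 'a \<Rightarrow> real" where "G \<equiv> birkhoff_sum T g"

lemma measurable_weight [measurable]: "g \<in> borel_measurable M"
  using integrable_weight by simp

lemma weight_nonneg: "g x \<ge> 0"
  using weight_pos by (rule less_imp_le)

lemma G_pos: "n \<ge> 1 \<Longrightarrow> G n x > 0"
  unfolding birkhoff_sum_def by (intro sum_pos) (auto simp: weight_pos lessThan_empty_iff)

lemma G_nonneg: "G n x \<ge> 0"
  by (intro birkhoff_sum_nonneg) (simp add: weight_nonneg)

lemma G_mono: "n \<le> m \<Longrightarrow> G n x \<le> G m x"
  unfolding birkhoff_sum_def by (intro sum_mono2) (auto simp: weight_nonneg)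

text \<open>This is where conservativity enters. If the series \<open>s\<close> of the weights
along the orbit of a point converges, then \<open>s\<close> is strictly smaller at the image of that point,
so some rational \<open>q\<close> separates the two values. As \<open>s\<close> never increases along an orbit, the set
of points separated by a given \<open>q\<close> never meets its own future, hence is null.\<close>

lemma weight_diverges: "AE x in M. filterlim (\<lambda>n. G n x) at_top sequentially"
proof -
  define s where "s x = (\<Sum>k. ennreal (g ((T ^^ k) x)))" for x
  have [measurable]: "s \<in> borel_measurable M"
    unfolding s_def[abs_def] by measurable
  have step: "s x = ennreal (g x) + s (T x)" for x
  proof -
    have "s x = (\<Sum>k. ennreal (g ((T ^^ (k + 1)) x))) + (\<Sum>k<1. ennreal (g ((T ^^ k) x)))"
      unfolding s_def by (rule suminf_offset) simp
    then show ?thesis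
      by (simp add: s_def funpow_swap1 add.commute)
  qed
  have decr: "s ((T ^^ n) x) \<le> s x" for n x
  proof (induction n)
    case (Suc n)
    have "s ((T ^^ Suc n) x) \<le> s ((T ^^ n) x)"
      by (simp add: step[of "(T ^^ n) x"])
    with Suc show ?case by (rule order_trans[rotated])
  qed simp
  define A where "A q = {x \<in> space M. s (T x) < ennreal (real_of_rat q) \<and> ennreal (real_of_rat q) < s x}" for q
  have A_sets [measurable]: "A q \<in> sets M" for q
    unfolding A_def by measurable
  have "emeasure M (A q) = 0" for q
  proof (rule ccontr)
    assume "emeasure M (A q) \<noteq> 0"
    then have "emeasure M (A q) > 0" by (simp add: zero_less_iff_neq_zero)
    then obtain n where n: "n \<ge> 1" "emeasure M (A q \<inter> (T ^^ n) -` A q) > 0"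
      using conservative A_sets unfolding conservative_map_def by metis
    have "A q \<inter> (T ^^ n) -` A q = {}"
    proof safe
      fix x assume x: "x \<in> A q" "(T ^^ n) x \<in> A q"
      obtain m where "n = Suc m" using n(1) by (cases n) auto
      then have "s ((T ^^ n) x) \<le> s (T x)"
        using decr[of m "T x"] by (simp add: funpow_swap1)
      then show "x \<in> {}" using x by (auto simp: A_def)
    qed
    then show False using n by simp
  qed
  then have "AE x in M. \<forall>q. x \<notin> A q"
    by (subst AE_all_countable) (auto intro!: AE_not_in simp: null_sets_def)
  then show ?thesis
  proof (rule AE_mp, intro AE_I2 impI)
    fix x assume x: "x \<in> space M" and nA: "\<forall>q. x \<notin> A q"
    have inf: "s x = \<infinity>"
    proof (rule ccontr)
      assume "s x \<noteq> \<infinity>"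
      moreover from this have "s (T x) \<noteq> \<infinity>"
        using step[of x] by auto
      ultimately have "s (T x) < s x"
        using weight_pos[of x] by (subst step) (auto simp: ennreal_add_left_cancel_less less_top)
      then obtain q where "s (T x) < ennreal (real_of_rat q)" "ennreal (real_of_rat q) < s x"
        using ennreal_rat_dense by blast
      then show False using nA x by (auto simp: A_def)
    qed
    have "incseq (\<lambda>n. G n x)"
      by (auto simp: incseq_def intro: G_mono)
    moreover have "\<not> (\<exists>L. (\<lambda>n. G n x) \<longlonglongrightarrow> L)"
    proof
      assume "\<exists>L. (\<lambda>n. G n x) \<longlonglongrightarrow> L"
      then have "summable (\<lambda>k. g ((T ^^ k) x))"
        by (auto simp: birkhoff_sum_def summable_def sums_def)
      then have "s x = ennreal (\<Sum>k. g ((T ^^ k) x))"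
        unfolding s_def by (intro suminf_ennreal2) (auto simp: weight_nonneg)
      then show False using inf by simp
    qed
    ultimately have "\<exists>n. G n x > B" for B
      using incseq_convergent[of "\<lambda>n. G n x" B] by (metis not_le)
    then show "filterlim (\<lambda>n. G n x) at_top sequentially"
      unfolding filterlim_at_top eventually_sequentially
      by (metis G_mono less_imp_le order_trans)
  qed
qed

text \<open>The Chacon--Ornstein lemma: single terms of an integrable Birkhoff sum are negligible against the
weight sums. Let \<open>p n\<close> be the positive part of \<open>d n = v \<circ> T ^^ n - e * G n\<close>. Since
\<open>d (Suc n) = d n \<circ> T - e * g\<close> and \<open>T\<close> preserves the measure, the integral of \<open>p\<close> drops from \<open>n\<close>
to \<open>Suc n\<close> by at least \<open>e\<close> times the integral of \<open>g\<close> over \<open>{d (Suc n) > 0}\<close>. These drops are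
summable, and the Borel--Cantelli lemma for the measure of density \<open>g\<close> concludes.\<close>

lemma iterate_over_weight_tendsto_0:
  assumes int: "integrable M v" and nonneg: "\<And>x. v x \<ge> 0"
  shows "AE x in M. (\<lambda>n. v ((T ^^ n) x) / G n x) \<longlonglongrightarrow> 0"
proof -
  have [measurable]: "v \<in> borel_measurable M" using int by simp
  have ev: "AE x in M. eventually (\<lambda>n. v ((T ^^ n) x) \<le> e * G n x) sequentially" if e: "e > 0" for e
  proof -
    define d where "d n x = v ((T ^^ n) x) - e * G n x" for n x
    define p where "p n x = max 0 (d n x)" for n x
    define E where "E n = {x \<in> space M. d (Suc n) x > 0}" for n
    have [measurable]: "d n \<in> borel_measurable M" for n
      unfolding d_def[abs_def] by measurable
    have E_sets [measurable]: "E n \<in> sets M" for n unfolding E_def by measurable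
    have int_d: "integrable M (d n)" for n
      unfolding d_def[abs_def]
      using int integrable_weight integrable_iterate integrable_birkhoff_sum by auto
    then have int_p: "integrable M (p n)" for n
      unfolding p_def[abs_def] by auto
    have int_E: "integrable M (\<lambda>x. g x * indicator (E n) x)" for n
      using integrable_weight by (intro integrable_real_mult_indicator) auto
    have drop: "p (Suc n) x + e * (g x * indicator (E n) x) \<le> p n (T x)" if "x \<in> space M" for n x
    proof -
      have "d (Suc n) x = d n (T x) - e * g x"
        by (simp add: d_def birkhoff_sum_Suc funpow_swap1 algebra_simps)
      then show ?thesis
        using that e weight_pos[of x] by (auto simp: p_def E_def split: split_indicator)
    qed
    have drop_int: "(\<integral>x. p (Suc n) x \<partial>M) + e * (\<integral>x. g x * indicator (E n) x \<partial>M) \<le> (\<integral>x. p n x \<partial>M)" for n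
    proof -
      have "(\<integral>x. p (Suc n) x + e * (g x * indicator (E n) x) \<partial>M) \<le> (\<integral>x. p n ((T ^^ 1) x) \<partial>M)"
        using int_p int_E integrable_iterate[OF int_p, of n 1] drop
        by (intro integral_mono) auto
      also have "\<dots> = (\<integral>x. p n x \<partial>M)"
        using int_p by (intro integral_iterate) auto
      finally show ?thesis using int_p int_E by simp
    qed
    have partial: "e * (\<Sum>i<n. \<integral>x. g x * indicator (E i) x \<partial>M) \<le> (\<integral>x. p 0 x \<partial>M) - (\<integral>x. p n x \<partial>M)" for n
    proof (induction n)
      case (Suc n)
      with drop_int[of n] show ?case by (simp add: algebra_simps)
    qed simp
    have p_nonneg: "(\<integral>x. p n x \<partial>M) \<ge> 0" for n
      by (intro integral_nonneg_AE) (auto simp: p_def)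
    have sm: "summable (\<lambda>i. \<integral>x. g x * indicator (E i) x \<partial>M)"
    proof (rule bounded_imp_summable)
      show "0 \<le> (\<integral>x. g x * indicator (E i) x \<partial>M)" for i
        by (intro integral_nonneg_AE) (auto simp: weight_nonneg)
      show "(\<Sum>k\<le>n. \<integral>x. g x * indicator (E k) x \<partial>M) \<le> (\<integral>x. p 0 x \<partial>M) / e" for n
        using partial[of "Suc n"] p_nonneg[of "Suc n"] e
        by (simp add: field_simps lessThan_Suc_atMost)
    qed
    \<comment> \<open>As \<open>g > 0\<close>, this measure has the same null sets as \<open>M\<close>.\<close>
    define N where "N = density M (\<lambda>x. ennreal (g x))"
    have em: "emeasure N (E n) = ennreal (\<integral>x. g x * indicator (E n) x \<partial>M)" for n
    proof -
      have "emeasure N (E n) = (\<integral>\<^sup>+x. ennreal (g x * indicator (E n) x) \<partial>M)"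
        unfolding N_def
        by (subst emeasure_density) (auto intro!: nn_integral_cong split: split_indicator)
      also have "\<dots> = ennreal (\<integral>x. g x * indicator (E n) x \<partial>M)"
        using int_E by (intro nn_integral_eq_integral) (auto simp: weight_nonneg)
      finally show ?thesis .
    qed
    have "measure N (E n) = (\<integral>x. g x * indicator (E n) x \<partial>M)" for n
      unfolding measure_def em
      by (intro enn2real_ennreal integral_nonneg_AE) (auto simp: weight_nonneg)
    then have "AE x in N. eventually (\<lambda>n. x \<in> space N - E n) sequentially"
      using sm em by (intro borel_cantelli_AE1) (auto simp: N_def)
    then have "AE x in M. eventually (\<lambda>n. x \<in> space M - E n) sequentially"
      unfolding N_def using weight_pos by (subst (asm) AE_density) auto
    then show ?thesis
    proof (rule AE_mp, intro AE_I2 impI)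
      fix x assume "eventually (\<lambda>n. x \<in> space M - E n) sequentially"
      then have "eventually (\<lambda>n. v ((T ^^ Suc n) x) \<le> e * G (Suc n) x) sequentially"
        by eventually_elim (auto simp: E_def d_def)
      then show "eventually (\<lambda>n. v ((T ^^ n) x) \<le> e * G n x) sequentially"
        by (rule eventually_sequentially_Suc[THEN iffD1])
    qed
  qed
  have "AE x in M. \<forall>j. eventually (\<lambda>n. v ((T ^^ n) x) \<le> inverse (real (Suc j)) * G n x) sequentially"
    by (subst AE_all_countable) (auto intro!: ev)
  then show ?thesis
  proof (rule AE_mp, intro AE_I2 impI)
    fix x assume *: "\<forall>j. eventually (\<lambda>n. v ((T ^^ n) x) \<le> inverse (real (Suc j)) * G n x) sequentially"
    show "(\<lambda>n. v ((T ^^ n) x) / G n x) \<longlonglongrightarrow> 0"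
    proof (rule LIMSEQ_I)
      fix r :: real assume "r > 0"
      then obtain j where j: "inverse (real (Suc j)) < r" using reals_Archimedean by blast
      from * have "eventually (\<lambda>n. v ((T ^^ n) x) \<le> inverse (real (Suc j)) * G n x) sequentially" by blast
      then have "eventually (\<lambda>n. norm (v ((T ^^ n) x) / G n x - 0) < r) sequentially"
        using eventually_ge_at_top[of "1::nat"]
      proof eventually_elim
        case (elim n)
        then have "v ((T ^^ n) x) / G n x \<le> inverse (real (Suc j))"
          using G_pos[of n x] by (simp add: field_simps)
        then show ?case using j nonneg[of "(T ^^ n) x"] G_nonneg[of n x]
          by (simp add: abs_of_nonneg del: inverse_eq_divide)
      qed
      then show "\<exists>no. \<forall>n\<ge>no. norm (v ((T ^^ n) x) / G n x - 0) < r"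
        by (simp add: eventually_sequentially)
    qed
  qed
qed

end

section \<open>Covering an orbit by good blocks\<close>

text \<open>The combinatorial core, for one orbit: \<open>c n k\<close> is the value of the \<open>n\<close>-th function at the
\<open>k\<close>-th point. Walk from \<open>k\<close> to \<open>K\<close>. At a good time jump to the end of a block of length at
most \<open>N\<close> on which \<open>c\<close> is controlled by \<open>H\<close>; at a bad time, or within distance \<open>N\<close> of the
end where the block might not fit, make a single step and pay the price \<open>u\<close>. Monotonicity of \<open>H\<close>
allows replacing its value at the start of a block by its values inside the block.\<close>

lemma orbit_covering:
  fixes c :: "nat \<Rightarrow> nat \<Rightarrow> real" and \<gamma> u H :: "nat \<Rightarrow> real"
  assumes zero: "\<And>k. c 0 k = 0"
    and sub: "\<And>n m k. c (n + m) k \<le> c n k + c m (k + n)"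
    and \<gamma>: "\<And>k. \<gamma> k \<ge> 0" and H: "mono H"
    and u: "\<And>k. u k \<ge> 0" "\<And>k. c 1 k \<le> H k * \<gamma> k + u k"
    and good: "\<And>k. k \<notin> B \<Longrightarrow> \<exists>n\<in>{1..N}. c n k \<le> H k * (\<Sum>j=k..<k+n. \<gamma> j)"
    and "k \<le> K"
  shows "c (K - k) k \<le> (\<Sum>j=k..<K. H j * \<gamma> j + (if j \<in> B \<or> K < j + N then u j else 0))"
  using \<open>k \<le> K\<close>
proof (induction "K - k" arbitrary: k rule: less_induct)
  case less
  let ?w = "\<lambda>j. H j * \<gamma> j + (if j \<in> B \<or> K < j + N then u j else 0)"
  consider "k = K" | "k < K" "k \<in> B \<or> K < k + N" | "k \<notin> B" "k + N \<le> K"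
    using less.prems by fastforce
  then show ?case
  proof cases
    case 1
    then show ?thesis by (simp add: zero)
  next
    case 2
    have "c (K - k) k \<le> c 1 k + c (K - Suc k) (Suc k)"
      using sub[of 1 "K - Suc k" k] 2 by (simp add: Suc_diff_Suc)
    also have "c 1 k \<le> ?w k" using 2 u by simp
    also have "c (K - Suc k) (Suc k) \<le> (\<Sum>j=Suc k..<K. ?w j)"
      using 2 by (intro less.hyps) auto
    also have "?w k + (\<Sum>j=Suc k..<K. ?w j) = (\<Sum>j=k..<K. ?w j)"
      using 2 by (simp add: sum.atLeast_Suc_lessThan)
    finally show ?thesis by simp
  next
    case 3
    then obtain n where n: "1 \<le> n" "n \<le> N" "c n k \<le> H k * (\<Sum>j=k..<k+n. \<gamma> j)"
      using good by force
    have "c (K - k) k \<le> c n k + c (K - (k + n)) (k + n)"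
      using sub[of n "K - (k + n)" k] 3 n by simp
    also have "c n k \<le> (\<Sum>j=k..<k+n. ?w j)"
    proof -
      have "H k * (\<Sum>j=k..<k+n. \<gamma> j) \<le> (\<Sum>j=k..<k+n. ?w j)"
        unfolding sum_distrib_left
      proof (rule sum_mono)
        fix j assume "j \<in> {k..<k+n}"
        then have "H k * \<gamma> j \<le> H j * \<gamma> j"
          using \<gamma> monoD[OF H] by (intro mult_right_mono) auto
        then show "H k * \<gamma> j \<le> ?w j" using u(1)[of j] by simp
      qed
      with n show ?thesis by simp
    qed
    also have "c (K - (k + n)) (k + n) \<le> (\<Sum>j=k+n..<K. ?w j)"
      using 3 n by (intro less.hyps) auto
    also have "(\<Sum>j=k..<k+n. ?w j) + (\<Sum>j=k+n..<K. ?w j) = (\<Sum>j=k..<K. ?w j)"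
      using 3 n by (intro sum.atLeastLessThan_concat) auto
    finally show ?thesis by simp
  qed
qed

context conservative_weighted
begin

text \<open>Integrating the covering estimate. The set \<open>B N\<close> of points with no good block of length
at most \<open>N\<close> shrinks to a null set, so the bad times cost at most \<open>K * e / 3\<close>, and the end of the
orbit costs at most \<open>N\<close> times the integral of \<open>u\<close>, which is negligible after division by \<open>K\<close>.\<close>

lemma eventually_mean_le_integral:
  assumes int: "\<And>n. integrable M (b n)" and zero: "\<And>x. b 0 x = 0"
    and sub: "AE x in M. \<forall>n m. b (n + m) x \<le> b n x + b m ((T ^^ n) x)"
    and lower: "\<And>x. - L \<le> \<psi> x" "L \<ge> 0"
    and int_\<psi>: "integrable M (\<lambda>x. \<psi> x * g x)"
    and [measurable]: "\<psi> \<in> borel_measurable M"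
    and mono: "AE x in M. \<psi> x \<le> \<psi> (T x)"
    and reach: "AE x in M. \<forall>e>0. \<exists>n\<ge>1. b n x \<le> (\<psi> x + e) * G n x"
    and "e > 0"
  shows "eventually (\<lambda>K. (\<integral>x. b K x \<partial>M) / real K \<le> (\<integral>x. \<psi> x * g x \<partial>M) + e) sequentially"
proof -
  have [measurable]: "b n \<in> borel_measurable M" for n using int by simp
  have g_int_nonneg: "(\<integral>x. g x \<partial>M) \<ge> 0"
    by (intro integral_nonneg_AE) (auto simp: weight_nonneg)
  \<comment> \<open>Tolerance in the definition of good blocks, so small that it costs at most \<open>e / 3\<close> per step.\<close>
  define d where "d = e / (3 * (1 + (\<integral>x. g x \<partial>M)))"
  have d: "d > 0" using \<open>e > 0\<close> g_int_nonneg by (simp add: d_def)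
  have d_int: "d * (\<integral>x. g x \<partial>M) \<le> e / 3"
    using \<open>e > 0\<close> g_int_nonneg by (simp add: d_def field_simps)
  \<comment> \<open>The summand \<open>L * g\<close> pays for \<open>\<psi> * g\<close> where \<open>\<psi>\<close> is negative.\<close>
  define u where "u x = \<bar>b 1 x\<bar> + L * g x" for x
  have u_nonneg: "u x \<ge> 0" for x
    using lower(2) weight_pos[of x] by (simp add: u_def)
  have int_u: "integrable M u"
    unfolding u_def[abs_def] using int integrable_weight by auto
  then have [measurable]: "u \<in> borel_measurable M" by simp
  define B where "B N = {x \<in> space M. \<forall>n\<in>{1..N}. b n x > (\<psi> x + d) * G n x}" for N
  have B_sets [measurable]: "B N \<in> sets M" for N
    unfolding B_def by measurable
  have int_uB: "integrable M (\<lambda>x. u x * indicator (B N) x)" for N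
    using int_u by (intro integrable_real_mult_indicator) auto
  have "(\<lambda>N. \<integral>x. u x * indicator (B N) x \<partial>M) \<longlonglongrightarrow> (\<integral>x. 0 \<partial>M)"
  proof (rule integral_dominated_convergence[where w = u])
    show "AE x in M. (\<lambda>N. u x * indicator (B N) x) \<longlonglongrightarrow> 0"
      using reach
    proof (rule AE_mp, intro AE_I2 impI)
      fix x assume "\<forall>e>0. \<exists>n\<ge>1. b n x \<le> (\<psi> x + e) * G n x"
      then obtain n where n: "n \<ge> 1" "b n x \<le> (\<psi> x + d) * G n x" using d by blast
      then have "\<forall>N\<ge>n. x \<notin> B N" by (force simp: B_def)
      then show "(\<lambda>N. u x * indicator (B N) x) \<longlonglongrightarrow> 0"
        by (intro tendsto_eventually) (auto simp: eventually_sequentially intro!: exI[of _ n])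
    qed
  qed (use int_u u_nonneg in \<open>auto split: split_indicator\<close>)
  then have "eventually (\<lambda>N. (\<integral>x. u x * indicator (B N) x \<partial>M) < e / 3) sequentially"
    using \<open>e > 0\<close> by (intro order_tendstoD(2)[where y = 0 and a = "e / 3"]) auto
  then obtain N where N: "(\<integral>x. u x * indicator (B N) x \<partial>M) < e / 3"
    by (auto simp: eventually_sequentially)
  define F where "F x = (\<psi> x * g x + d * g x) + u x * indicator (B N) x" for x
  have int_F: "integrable M F"
    unfolding F_def[abs_def] using int_\<psi> integrable_weight int_uB by auto
  have F_le: "(\<integral>x. F x \<partial>M) \<le> (\<integral>x. \<psi> x * g x \<partial>M) + 2 * e / 3"
    unfolding F_def using int_\<psi> integrable_weight int_uB N d_int by simp
  define R where "R K x = (\<Sum>j<K. if K < j + N then u ((T ^^ j) x) else 0)" for K x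
  have int_if: "integrable M (\<lambda>x. if K < j + N then u ((T ^^ j) x) else 0)" for K j
    by (cases "K < j + N") (simp_all add: integrable_iterate int_u)
  then have int_R: "integrable M (R K)" for K
    unfolding R_def[abs_def] by (intro Bochner_Integration.integrable_sum)
  have R_le: "(\<integral>x. R K x \<partial>M) \<le> real N * (\<integral>x. u x \<partial>M)" for K
  proof -
    have "(\<integral>x. R K x \<partial>M) = (\<Sum>j<K. \<integral>x. (if K < j + N then u ((T ^^ j) x) else 0) \<partial>M)"
      unfolding R_def by (intro Bochner_Integration.integral_sum int_if)
    also have "\<dots> = (\<Sum>j<K. if K < j + N then (\<integral>x. u x \<partial>M) else 0)"
      by (intro sum.cong) (auto simp: integral_iterate)
    also have "\<dots> = real (card {j\<in>{..<K}. K < j + N}) * (\<integral>x. u x \<partial>M)"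
      by (subst sum.If_cases) (auto simp: Int_def)
    also have "\<dots> \<le> real N * (\<integral>x. u x \<partial>M)"
    proof (intro mult_right_mono)
      have "card {j\<in>{..<K}. K < j + N} \<le> card {K - N..<K}"
        by (intro card_mono) auto
      then show "real (card {j\<in>{..<K}. K < j + N}) \<le> real N" by simp
    qed (use u_nonneg in \<open>auto intro!: integral_nonneg_AE\<close>)
    finally show ?thesis .
  qed
  have orbit_bound: "AE x in M. \<forall>K. b K x \<le> birkhoff_sum T F K x + R K x"
    using AE_orbit[OF sub] AE_orbit[OF mono] AE_space
  proof eventually_elim
    case (elim x)
    have space: "(T ^^ k) x \<in> space M" for k
      using elim(3) measurable_iterate[of k] by (auto simp: measurable_def)
    show ?case
    proof
      fix K
      let ?B = "{k. (T ^^ k) x \<in> B N}"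
      have "b (K - 0) ((T ^^ 0) x) \<le> (\<Sum>j=0..<K. (\<psi> ((T ^^ j) x) + d) * g ((T ^^ j) x)
          + (if j \<in> ?B \<or> K < j + N then u ((T ^^ j) x) else 0))"
      proof (rule orbit_covering[where c = "\<lambda>n k. b n ((T ^^ k) x)" and \<gamma> = "\<lambda>k. g ((T ^^ k) x)"
            and H = "\<lambda>k. \<psi> ((T ^^ k) x) + d" and u = "\<lambda>k. u ((T ^^ k) x)"])
        show "b (n + m) ((T ^^ k) x) \<le> b n ((T ^^ k) x) + b m ((T ^^ (k + n)) x)" for n m k
          using elim(1) by (simp add: add.commute[of k n] funpow_add)
        show "mono (\<lambda>k. \<psi> ((T ^^ k) x) + d)"
          using elim(2) by (intro incseq_SucI) auto
        show "\<exists>n\<in>{1..N}. b n ((T ^^ k) x) \<le> (\<psi> ((T ^^ k) x) + d) * (\<Sum>j = k..<k + n. g ((T ^^ j) x))"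
          if "k \<notin> ?B" for k
        proof -
          have "(\<Sum>j = k..<k + n. g ((T ^^ j) x)) = G n ((T ^^ k) x)" for n
          proof -
            have "(\<Sum>j = k..<k + n. g ((T ^^ j) x)) = (\<Sum>j<n. g ((T ^^ (j + k)) x))"
              using sum.shift_bounds_nat_ivl[of "\<lambda>j. g ((T ^^ j) x)" 0 k n]
              by (simp add: add.commute lessThan_atLeast0)
            then show ?thesis by (simp add: birkhoff_sum_def funpow_add)
          qed
          with that space[of k] show ?thesis
            by (auto simp: B_def not_less)
        qed
        show "b 1 ((T ^^ k) x) \<le> (\<psi> ((T ^^ k) x) + d) * g ((T ^^ k) x) + u ((T ^^ k) x)" for k
        proof -
          have "0 \<le> (\<psi> ((T ^^ k) x) + d + L) * g ((T ^^ k) x)"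
            using lower(1)[of "(T ^^ k) x"] d weight_pos[of "(T ^^ k) x"] by simp
          then show ?thesis by (simp add: u_def algebra_simps)
        qed
      qed (simp_all add: zero u_nonneg weight_nonneg)
      also have "\<dots> \<le> (\<Sum>j=0..<K. F ((T ^^ j) x) + (if K < j + N then u ((T ^^ j) x) else 0))"
        using u_nonneg by (intro sum_mono) (auto simp: F_def algebra_simps split: split_indicator)
      also have "\<dots> = birkhoff_sum T F K x + R K x"
        by (simp add: birkhoff_sum_def R_def sum.distrib lessThan_atLeast0)
      finally show "b K x \<le> birkhoff_sum T F K x + R K x" by simp
    qed
  qed
  have mean: "(\<integral>x. b K x \<partial>M) \<le> real K * ((\<integral>x. \<psi> x * g x \<partial>M) + 2 * e / 3) + real N * (\<integral>x. u x \<partial>M)" for K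
  proof -
    have "(\<integral>x. b K x \<partial>M) \<le> (\<integral>x. birkhoff_sum T F K x + R K x \<partial>M)"
      using orbit_bound int int_R integrable_birkhoff_sum[OF int_F]
      by (intro integral_mono_AE) auto
    also have "\<dots> = real K * (\<integral>x. F x \<partial>M) + (\<integral>x. R K x \<partial>M)"
      using int_R integrable_birkhoff_sum[OF int_F] by (simp add: integral_birkhoff_sum int_F)
    also have "\<dots> \<le> real K * ((\<integral>x. \<psi> x * g x \<partial>M) + 2 * e / 3) + real N * (\<integral>x. u x \<partial>M)"
      using R_le F_le by (intro add_mono mult_left_mono) auto
    finally show ?thesis .
  qed
  obtain K0 :: nat where K0: "3 * (real N * (\<integral>x. u x \<partial>M)) / e < real K0"
    using reals_Archimedean2 by blast
  show ?thesis
    unfolding eventually_sequentially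
  proof (intro exI[of _ "Suc K0"] allI impI)
    fix K assume "Suc K0 \<le> K"
    then have "real K0 \<le> real K" and K: "real K > 0" by auto
    have "3 * (real N * (\<integral>x. u x \<partial>M)) \<le> real K0 * e"
      using K0 \<open>e > 0\<close> by (simp add: field_simps)
    also have "\<dots> \<le> real K * e"
      using \<open>real K0 \<le> real K\<close> \<open>e > 0\<close> by (intro mult_right_mono) auto
    finally have "3 * (real N * (\<integral>x. u x \<partial>M)) \<le> real K * e" .
    then have "(\<integral>x. b K x \<partial>M) \<le> real K * ((\<integral>x. \<psi> x * g x \<partial>M) + e)"
      using mean[of K] by (simp add: algebra_simps)
    then show "(\<integral>x. b K x \<partial>M) / real K \<le> (\<integral>x. \<psi> x * g x \<partial>M) + e"
      using K by (simp add: field_simps)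
  qed
qed

text \<open>Splitting off the first step gives \<open>b (n + 1) x \<le> b 1 x + b n (T x)\<close>, and dividing by the
diverging weight sums makes \<open>b 1 x\<close> disappear. This is the monotonicity along orbits that the
covering argument asks for.\<close>

lemma liminf_ratio_mono:
  assumes sub: "AE x in M. \<forall>n m. b (n + m) x \<le> b n x + b m ((T ^^ n) x)"
  shows "AE x in M. liminf (\<lambda>n. ereal (b n x / G n x)) \<le> liminf (\<lambda>n. ereal (b n (T x) / G n (T x)))"
  using sub AE_orbit[OF weight_diverges]
proof eventually_elim
  case (elim x)
  define t where "t n = G n (T x)" for n
  have t: "filterlim t at_top sequentially"
    unfolding t_def using elim(2)[rule_format, of 1] by simp
  have const_over_t: "(\<lambda>n. a / (g x + t n)) \<longlonglongrightarrow> 0" for a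
    by (intro tendsto_divide_0[OF tendsto_const] filterlim_at_top_imp_at_infinity
        filterlim_tendsto_add_at_top[OF tendsto_const] t)
  have "(\<lambda>n. 1 - g x / (g x + t n)) \<longlonglongrightarrow> 1 - 0"
    by (intro tendsto_diff tendsto_const const_over_t)
  also have "(\<lambda>n. 1 - g x / (g x + t n)) = (\<lambda>n. t n / (g x + t n))"
  proof
    fix n show "1 - g x / (g x + t n) = t n / (g x + t n)"
      using weight_pos[of x] G_nonneg[of n "T x"] by (simp add: t_def field_simps)
  qed
  finally have ratio: "(\<lambda>n. ereal (t n / (g x + t n))) \<longlonglongrightarrow> 1"
    by (simp add: one_ereal_def)
  have first: "(\<lambda>n. ereal (b 1 x / (g x + t n))) \<longlonglongrightarrow> 0"
    using const_over_t[of "b 1 x"] by (simp add: zero_ereal_def)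
  have "liminf (\<lambda>n. ereal (b n x / G n x)) = liminf (\<lambda>n. ereal (b (n + 1) x / G (n + 1) x))"
    by (rule liminf_shift[symmetric])
  also have "\<dots> \<le> liminf (\<lambda>n. ereal (b 1 x / (g x + t n)) + ereal (t n / (g x + t n)) * ereal (b n (T x) / t n))"
  proof (rule Liminf_mono, rule eventually_mono[OF eventually_ge_at_top[of "1::nat"]])
    fix n :: nat assume n: "1 \<le> n"
    have tp: "t n > 0" using G_pos[OF n] by (simp add: t_def)
    have G_Suc: "G (n + 1) x = g x + t n"
      by (simp add: birkhoff_sum_Suc t_def)
    have "b (1 + n) x \<le> b 1 x + b n (T x)" using elim(1)[rule_format, of 1 n] by simp
    then have "b (n + 1) x / G (n + 1) x \<le> (b 1 x + b n (T x)) / (g x + t n)"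
      unfolding G_Suc using tp weight_pos[of x] by (intro divide_right_mono) (auto simp: add.commute)
    also have "\<dots> = b 1 x / (g x + t n) + t n / (g x + t n) * (b n (T x) / t n)"
      using tp by (simp add: add_divide_distrib)
    finally show "ereal (b (n + 1) x / G (n + 1) x)
      \<le> ereal (b 1 x / (g x + t n)) + ereal (t n / (g x + t n)) * ereal (b n (T x) / t n)"
      by simp
  qed
  also have "\<dots> = 0 + liminf (\<lambda>n. ereal (t n / (g x + t n)) * ereal (b n (T x) / t n))"
    using first by (intro ereal_liminf_lim_add) auto
  also have "\<dots> = liminf (\<lambda>n. ereal (b n (T x) / t n))"
    by (subst ereal_liminf_lim_mult[OF ratio]) auto
  finally show ?case by (simp add: t_def)
qed

text \<open>The lower limit of the ratios, cut off at \<open>- L\<close>, meets the requirements of the covering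
argument: below any larger value there are infinitely many ratios. The cut-off keeps the cost of
bad times finite when the lower limit is unbounded below.\<close>

lemma eventually_mean_le_integral_liminf:
  assumes int: "\<And>n. integrable M (b n)" and zero: "\<And>x. b 0 x = 0"
    and sub: "AE x in M. \<forall>n m. b (n + m) x \<le> b n x + b m ((T ^^ n) x)"
    and "L \<ge> 0"
    and \<psi>_def: "\<And>x. \<psi> x = real_of_ereal (max (liminf (\<lambda>n. ereal (b n x / G n x))) (ereal (- L)))"
    and fin: "AE x in M. liminf (\<lambda>n. ereal (b n x / G n x)) < \<infinity>"
    and int_\<psi>: "integrable M (\<lambda>x. \<psi> x * g x)"
    and "e > 0"
  shows "eventually (\<lambda>K. (\<integral>x. b K x \<partial>M) / real K \<le> (\<integral>x. \<psi> x * g x \<partial>M) + e) sequentially"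
proof -
  define \<phi> where "\<phi> x = liminf (\<lambda>n. ereal (b n x / G n x))" for x
  have [measurable]: "b n \<in> borel_measurable M" for n using int by simp
  have [measurable]: "\<phi> \<in> borel_measurable M"
    unfolding \<phi>_def[abs_def] by measurable
  have \<psi>: "\<psi> x = real_of_ereal (max (\<phi> x) (ereal (- L)))" for x
    by (simp add: \<psi>_def \<phi>_def)
  have \<psi>_meas: "\<psi> \<in> borel_measurable M"
    unfolding \<psi>[abs_def] by measurable
  have \<psi>_eq: "ereal (\<psi> x) = max (\<phi> x) (ereal (- L))" if "\<phi> x < \<infinity>" for x
    unfolding \<psi> using that by (intro ereal_real') (cases "\<phi> x", auto simp: max_def)
  have lower: "- L \<le> \<psi> x" for x
    unfolding \<psi> using \<open>L \<ge> 0\<close> by (cases "\<phi> x") (auto simp: max_def)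
  have mono: "AE x in M. \<psi> x \<le> \<psi> (T x)"
    using liminf_ratio_mono[OF sub] AE_orbit[OF fin]
  proof eventually_elim
    case (elim x)
    have "\<phi> x < \<infinity>" "\<phi> (T x) < \<infinity>"
      using elim(2)[rule_format, of 0] elim(2)[rule_format, of 1] by (auto simp: \<phi>_def)
    moreover have "\<phi> x \<le> \<phi> (T x)" using elim(1) by (simp add: \<phi>_def)
    ultimately have "ereal (\<psi> x) \<le> ereal (\<psi> (T x))"
      by (simp only: \<psi>_eq) (rule max.mono, auto)
    then show ?case by simp
  qed
  have reach: "AE x in M. \<forall>e>0. \<exists>n\<ge>1. b n x \<le> (\<psi> x + e) * G n x"
    using fin
  proof eventually_elim
    case (elim x)
    show ?case
    proof (intro allI impI, rule ccontr)
      fix e :: real assume "e > 0" and neg: "\<not> (\<exists>n\<ge>1. b n x \<le> (\<psi> x + e) * G n x)"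
      have "eventually (\<lambda>n. ereal (\<psi> x + e) \<le> ereal (b n x / G n x)) sequentially"
        using eventually_ge_at_top[of "1::nat"]
      proof eventually_elim
        case (elim n)
        then have "(\<psi> x + e) * G n x \<le> b n x" using neg by force
        then show ?case using G_pos[OF elim, of x] by (simp add: field_simps)
      qed
      then have "ereal (\<psi> x + e) \<le> \<phi> x" unfolding \<phi>_def by (rule Liminf_bounded)
      also have "\<phi> x \<le> ereal (\<psi> x)" using elim \<psi>_eq[of x] by (simp add: \<phi>_def)
      finally show False using \<open>e > 0\<close> by simp
    qed
  qed
  show ?thesis
    by (rule eventually_mean_le_integral[OF int zero sub lower \<open>L \<ge> 0\<close> int_\<psi> \<psi>_meas mono reach \<open>e > 0\<close>])
qed

end

section \<open>The ratio ergodic theorem\<close>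

context conservative_weighted
begin

lemma AE_eq_if_weighted_integral_le:
  assumes "AE x in M. v x \<le> u x"
    and "integrable M (\<lambda>x. v x * g x)" "integrable M (\<lambda>x. u x * g x)"
    and "(\<integral>x. u x * g x \<partial>M) \<le> (\<integral>x. v x * g x \<partial>M)"
  shows "AE x in M. v x = u x"
proof -
  have le: "AE x in M. v x * g x \<le> u x * g x"
    using assms(1) by eventually_elim (simp add: weight_nonneg mult_right_mono)
  have "(\<integral>x. v x * g x \<partial>M) \<le> (\<integral>x. u x * g x \<partial>M)"
    by (rule integral_mono_AE[OF assms(2,3) le])
  then have zero: "(\<integral>x. u x * g x - v x * g x \<partial>M) = 0"
    using assms by simp
  have "AE x in M. u x * g x - v x * g x = 0"
    by (rule integral_nonneg_eq_0_iff_AE[THEN iffD1, OF _ _ zero])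
       (use assms in simp, use le in eventually_elim, simp)
  then show ?thesis
  proof eventually_elim
    case (elim x)
    then show ?case using weight_pos[of x] by simp
  qed
qed

text \<open>Upper limits are reached by applying the lower estimate to the additive sequence of the negated
Birkhoff sums, whose ratios have lower limit \<open>- U\<close>. The cut-off at \<open>- L\<close> turns into the
truncation \<open>c L\<close> of \<open>U\<close> at \<open>L\<close>, and monotone convergence removes it.\<close>

lemma integrable_limsup_ratio:
  assumes int: "integrable M f" and nonneg: "\<And>x. f x \<ge> 0"
  defines "U \<equiv> \<lambda>x. limsup (\<lambda>n. ereal (birkhoff_sum T f n x / G n x))"
  shows "AE x in M. U x < \<infinity>" and "integrable M (\<lambda>x. real_of_ereal (U x) * g x)"
    and "(\<integral>x. real_of_ereal (U x) * g x \<partial>M) \<le> (\<integral>x. f x \<partial>M)"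
proof -
  have [measurable]: "f \<in> borel_measurable M" using int by simp
  have [measurable]: "U \<in> borel_measurable M" unfolding U_def by measurable
  have S_nonneg: "birkhoff_sum T f n x \<ge> 0" for n x by (intro birkhoff_sum_nonneg nonneg)
  have "0 \<le> liminf (\<lambda>n. ereal (birkhoff_sum T f n x / G n x))" for x
    using S_nonneg G_nonneg by (intro Liminf_bounded always_eventually) auto
  then have U_nonneg: "0 \<le> U x" for x
    unfolding U_def by (rule order_trans) (rule Liminf_le_Limsup, simp)
  define b where "b n x = - birkhoff_sum T f n x" for n x
  have lim_b: "liminf (\<lambda>n. ereal (b n x / G n x)) = - U x" for x
    unfolding b_def U_def by (simp add: ereal_Liminf_uminus flip: uminus_ereal.simps(1))
  define c where "c L x = real_of_ereal (min (U x) (ereal (real L)))" for L :: nat and x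
  have c_bounds: "0 \<le> c L x" "c L x \<le> real L" for L x
    using U_nonneg[of x] unfolding c_def by (cases "U x"; auto simp: min_def)+
  have [measurable]: "c L \<in> borel_measurable M" for L unfolding c_def[abs_def] by measurable
  have int_c: "integrable M (\<lambda>x. c L x * g x)" for L
    using c_bounds weight_pos
    by (intro Bochner_Integration.integrable_bound[OF integrable_mult_right[OF integrable_weight, of "real L"]])
       (auto simp: abs_mult intro!: AE_I2 mult_right_mono)
  have c_le: "(\<integral>x. c L x * g x \<partial>M) \<le> (\<integral>x. f x \<partial>M)" for L
  proof (rule field_le_epsilon)
    fix e :: real assume "e > 0"
    have "eventually (\<lambda>K. (\<integral>x. b K x \<partial>M) / real K \<le> (\<integral>x. - c L x * g x \<partial>M) + e) sequentially"
    proof (rule eventually_mean_le_integral_liminf[where L = "real L"])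
      show "integrable M (b n)" for n
        unfolding b_def using integrable_birkhoff_sum[OF int] by simp
      show "AE x in M. \<forall>n m. b (n + m) x \<le> b n x + b m ((T ^^ n) x)"
        by (simp add: b_def birkhoff_sum_add)
      show "- c L x = real_of_ereal (max (liminf (\<lambda>n. ereal (b n x / G n x))) (ereal (- real L)))" for x
        unfolding c_def lim_b by (cases "U x") (auto simp: min_def max_def)
      show "AE x in M. liminf (\<lambda>n. ereal (b n x / G n x)) < \<infinity>"
        unfolding lim_b
      proof (rule AE_I2)
        show "- U x < \<infinity>" for x using U_nonneg[of x] by (cases "U x") auto
      qed
    qed (use \<open>e > 0\<close> int_c in \<open>auto simp: b_def\<close>)
    then obtain K :: nat where "K \<ge> 1" "(\<integral>x. b K x \<partial>M) / real K \<le> (\<integral>x. - c L x * g x \<partial>M) + e"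
      unfolding eventually_sequentially by (metis linear)
    then show "(\<integral>x. c L x * g x \<partial>M) \<le> (\<integral>x. f x \<partial>M) + e"
      using integral_birkhoff_sum[OF int, of K] by (simp add: b_def)
  qed
  have f_int_nonneg: "(\<integral>x. f x \<partial>M) \<ge> 0" by (intro integral_nonneg_AE) (auto simp: nonneg)
  define D where "D x = (SUP L. ennreal (c L x * g x))" for x
  have "(\<integral>\<^sup>+x. D x \<partial>M) = (SUP L. \<integral>\<^sup>+x. ennreal (c L x * g x) \<partial>M)"
    unfolding D_def
  proof (rule nn_integral_monotone_convergence_SUP)
    have "c L x \<le> c L' x" if "L \<le> L'" for L L' x
      using that U_nonneg[of x] unfolding c_def by (cases "U x") (auto simp: min_def)
    then show "incseq (\<lambda>L x. ennreal (c L x * g x))"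
      by (auto simp: incseq_def le_fun_def weight_nonneg intro!: ennreal_leI mult_right_mono)
  qed simp
  also have "\<dots> \<le> ennreal (\<integral>x. f x \<partial>M)"
  proof (rule SUP_least)
    fix L
    have "(\<integral>\<^sup>+x. ennreal (c L x * g x) \<partial>M) = ennreal (\<integral>x. c L x * g x \<partial>M)"
      using c_bounds by (intro nn_integral_eq_integral int_c) (auto simp: weight_nonneg)
    then show "(\<integral>\<^sup>+x. ennreal (c L x * g x) \<partial>M) \<le> ennreal (\<integral>x. f x \<partial>M)"
      using c_le by (simp add: ennreal_leI)
  qed
  finally have D_int: "(\<integral>\<^sup>+x. D x \<partial>M) \<le> ennreal (\<integral>x. f x \<partial>M)" .
  have [measurable]: "D \<in> borel_measurable M" unfolding D_def[abs_def] by measurable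
  have D_fin: "AE x in M. D x \<noteq> \<infinity>"
    using D_int by (intro nn_integral_PInf_AE) (auto simp: top_unique)
  show fin: "AE x in M. U x < \<infinity>"
    using D_fin
  proof eventually_elim
    case (elim x)
    show ?case
    proof (rule ccontr)
      assume "\<not> U x < \<infinity>"
      then have c: "c L x = real L" for L by (simp add: c_def)
      have "ennreal (real L * g x) \<le> D x" for L
        unfolding D_def using SUP_upper[of L UNIV "\<lambda>L. ennreal (c L x * g x)"] by (simp add: c)
      moreover obtain r where "D x = ennreal r" "r \<ge> 0" using elim by (cases "D x") auto
      ultimately have "real L * g x \<le> r" for L by simp
      moreover obtain L where "r / g x < real L" using reals_Archimedean2 by blast
      ultimately show False using weight_pos[of x] by (simp add: field_simps) (meson not_le)
    qed
  qed
  have le_D: "AE x in M. ennreal (real_of_ereal (U x) * g x) \<le> D x"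
    using fin
  proof eventually_elim
    case (elim x)
    then obtain r where r: "U x = ereal r" "r \<ge> 0" using U_nonneg[of x] by (cases "U x") auto
    obtain L where "r < real L" using reals_Archimedean2 by blast
    then have "c L x = r" using r by (simp add: c_def)
    then show ?case
      unfolding D_def using r SUP_upper[of L UNIV "\<lambda>L. ennreal (c L x * g x)"] by simp
  qed
  have nn_U: "AE x in M. 0 \<le> real_of_ereal (U x) * g x"
    using U_nonneg by (auto simp: real_of_ereal_pos weight_nonneg)
  have U_le: "(\<integral>\<^sup>+x. ennreal (real_of_ereal (U x) * g x) \<partial>M) \<le> ennreal (\<integral>x. f x \<partial>M)"
    using nn_integral_mono_AE[OF le_D] D_int by (rule order_trans)
  show int_U: "integrable M (\<lambda>x. real_of_ereal (U x) * g x)"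
    using U_le by (intro integrableI_nonneg nn_U) (auto simp: less_top[symmetric] top_unique)
  show "(\<integral>x. real_of_ereal (U x) * g x \<partial>M) \<le> (\<integral>x. f x \<partial>M)"
    using U_le f_int_nonneg nn_integral_eq_integral[OF int_U nn_U] by simp
qed

text \<open>The integral of \<open>f\<close> dominates the weighted integral of the upper limit, and, by the lower
estimate for the Birkhoff sums of \<open>f\<close> themselves, is dominated by that of the lower limit.\<close>

lemma ratio_ergodic_nonneg:
  assumes int: "integrable M f" and nonneg: "\<And>x. f x \<ge> 0"
  shows "\<exists>c\<in>borel_measurable M. (AE x in M. (\<lambda>n. birkhoff_sum T f n x / G n x) \<longlonglongrightarrow> c x) \<and>
    integrable M (\<lambda>x. c x * g x) \<and> (\<integral>x. c x * g x \<partial>M) = (\<integral>x. f x \<partial>M)"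
proof -
  define U where "U x = limsup (\<lambda>n. ereal (birkhoff_sum T f n x / G n x))" for x
  define V where "V x = liminf (\<lambda>n. ereal (birkhoff_sum T f n x / G n x))" for x
  have [measurable]: "f \<in> borel_measurable M" using int by simp
  have [measurable]: "U \<in> borel_measurable M" unfolding U_def by measurable
  have [measurable]: "V \<in> borel_measurable M" unfolding V_def by measurable
  have U_fin: "AE x in M. U x < \<infinity>" and int_U: "integrable M (\<lambda>x. real_of_ereal (U x) * g x)"
    and U_le: "(\<integral>x. real_of_ereal (U x) * g x \<partial>M) \<le> (\<integral>x. f x \<partial>M)"
    using integrable_limsup_ratio[OF int nonneg] unfolding U_def by auto
  have S_nonneg: "birkhoff_sum T f n x \<ge> 0" for n x by (intro birkhoff_sum_nonneg nonneg)
  have V_nonneg: "0 \<le> V x" for x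
    unfolding V_def using S_nonneg G_nonneg by (intro Liminf_bounded always_eventually) auto
  have VU: "V x \<le> U x" for x unfolding V_def U_def by (rule Liminf_le_Limsup) simp
  define v where "v x = real_of_ereal (V x)" for x
  define u where "u x = real_of_ereal (U x)" for x
  have [measurable]: "u \<in> borel_measurable M" "v \<in> borel_measurable M"
    unfolding u_def[abs_def] v_def[abs_def] by measurable
  have uv: "AE x in M. 0 \<le> v x \<and> v x \<le> u x"
    using U_fin
  proof eventually_elim
    case (elim x)
    then show ?case using V_nonneg[of x] VU[of x] unfolding u_def v_def
      by (cases "U x"; cases "V x") auto
  qed
  have ug_vg: "AE x in M. 0 \<le> v x * g x \<and> v x * g x \<le> u x * g x"
    using uv by eventually_elim (simp add: weight_nonneg mult_right_mono)
  have int_u: "integrable M (\<lambda>x. u x * g x)"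
    using int_U by (simp add: u_def)
  have int_v: "integrable M (\<lambda>x. v x * g x)"
    by (rule Bochner_Integration.integrable_bound[OF int_u], measurable)
       (use ug_vg in eventually_elim, simp)
  have f_le: "(\<integral>x. f x \<partial>M) \<le> (\<integral>x. v x * g x \<partial>M)"
  proof (rule field_le_epsilon)
    fix e :: real assume "e > 0"
    have "eventually (\<lambda>K. (\<integral>x. birkhoff_sum T f K x \<partial>M) / real K \<le> (\<integral>x. v x * g x \<partial>M) + e) sequentially"
    proof (rule eventually_mean_le_integral_liminf[where L = 0])
      show "integrable M (birkhoff_sum T f n)" for n
        using integrable_birkhoff_sum[OF int] .
      show "AE x in M. \<forall>n m. birkhoff_sum T f (n + m) x \<le> birkhoff_sum T f n x + birkhoff_sum T f m ((T ^^ n) x)"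
        by (simp add: birkhoff_sum_add)
      show "v x = real_of_ereal (max (liminf (\<lambda>n. ereal (birkhoff_sum T f n x / G n x))) (ereal (- 0)))" for x
        using V_nonneg[of x] unfolding v_def V_def[symmetric] by (simp add: zero_ereal_def[symmetric] max_absorb1)
      show "AE x in M. liminf (\<lambda>n. ereal (birkhoff_sum T f n x / G n x)) < \<infinity>"
        using U_fin unfolding V_def[symmetric] by eventually_elim (rule order_le_less_trans[OF VU])
    qed (use \<open>e > 0\<close> int_v in auto)
    then obtain K :: nat where "K \<ge> 1" "(\<integral>x. birkhoff_sum T f K x \<partial>M) / real K \<le> (\<integral>x. v x * g x \<partial>M) + e"
      unfolding eventually_sequentially by (metis linear)
    then show "(\<integral>x. f x \<partial>M) \<le> (\<integral>x. v x * g x \<partial>M) + e"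
      using integral_birkhoff_sum[OF int, of K] by simp
  qed
  have vu_le: "(\<integral>x. v x * g x \<partial>M) \<le> (\<integral>x. u x * g x \<partial>M)"
    by (rule integral_mono_AE[OF int_v int_u]) (use ug_vg in eventually_elim, simp)
  have "AE x in M. v x = u x"
    using uv int_v int_u U_le f_le unfolding u_def[symmetric]
    by (intro AE_eq_if_weighted_integral_le) auto
  then have "AE x in M. (\<lambda>n. birkhoff_sum T f n x / G n x) \<longlonglongrightarrow> u x"
    using U_fin
  proof eventually_elim
    case (elim x)
    have "U x = ereal (u x)" "V x = ereal (v x)"
      using elim V_nonneg[of x] VU[of x] unfolding u_def v_def by (cases "U x"; cases "V x"; auto)+
    with elim(1) have "(\<lambda>n. ereal (birkhoff_sum T f n x / G n x)) \<longlonglongrightarrow> ereal (u x)"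
      unfolding U_def V_def by (intro Liminf_eq_Limsup) auto
    then show ?case by simp
  qed
  then show ?thesis
    using U_le f_le vu_le int_u unfolding u_def[symmetric] by (intro bexI[of _ u]) auto
qed

text \<open>Hopf's ratio ergodic theorem. The limits for the positive and the negative part of \<open>f\<close> are
finite, so they can be subtracted.\<close>

theorem ratio_ergodic:
  assumes int: "integrable M f"
  shows "\<exists>c\<in>borel_measurable M. (AE x in M. (\<lambda>n. birkhoff_sum T f n x / G n x) \<longlonglongrightarrow> c x) \<and>
    integrable M (\<lambda>x. c x * g x) \<and> (\<integral>x. c x * g x \<partial>M) = (\<integral>x. f x \<partial>M)"
proof -
  define p where "p x = max 0 (f x)" for x
  define q where "q x = max 0 (- f x)" for x
  have int_pq: "integrable M p" "integrable M q"
    unfolding p_def[abs_def] q_def[abs_def] using int by auto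
  have f_eq: "f = (\<lambda>x. p x - q x)" by (auto simp: p_def q_def)
  obtain c where c: "c \<in> borel_measurable M" "AE x in M. (\<lambda>n. birkhoff_sum T p n x / G n x) \<longlonglongrightarrow> c x"
    "integrable M (\<lambda>x. c x * g x)" "(\<integral>x. c x * g x \<partial>M) = (\<integral>x. p x \<partial>M)"
    using ratio_ergodic_nonneg[OF int_pq(1)] by (auto simp: p_def)
  obtain d where d: "d \<in> borel_measurable M" "AE x in M. (\<lambda>n. birkhoff_sum T q n x / G n x) \<longlonglongrightarrow> d x"
    "integrable M (\<lambda>x. d x * g x)" "(\<integral>x. d x * g x \<partial>M) = (\<integral>x. q x \<partial>M)"
    using ratio_ergodic_nonneg[OF int_pq(2)] by (auto simp: q_def)
  have "AE x in M. (\<lambda>n. birkhoff_sum T f n x / G n x) \<longlonglongrightarrow> c x - d x"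
    using c(2) d(2)
  proof eventually_elim
    case (elim x)
    have "birkhoff_sum T f n x / G n x = birkhoff_sum T p n x / G n x - birkhoff_sum T q n x / G n x" for n
      by (simp add: f_eq birkhoff_sum_def sum_subtractf diff_divide_distrib)
    with tendsto_diff[OF elim] show ?case by simp
  qed
  then show ?thesis
    using c d int_pq by (intro bexI[of _ "\<lambda>x. c x - d x"]) (auto simp: f_eq left_diff_distrib)
qed

end

section \<open>Subadditive sequences bounded below\<close>

text \<open>The sliding sum \<open>W n\<close> of \<open>c (n + i) 0\<close> over \<open>i < m\<close> satisfies
\<open>W (n + 1) - W n = c (n + m) 0 - c n 0 \<le> c m n\<close>, so \<open>W n\<close> is bounded by \<open>W 0\<close> plus the sum of
\<open>c m k\<close> over \<open>k < n\<close>; and each of its \<open>m\<close> terms is at least \<open>c (n + m) 0\<close> up to at most \<open>m\<close>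
values of \<open>f\<close> near time \<open>n\<close>.\<close>

lemma subadditive_averaging:
  fixes c :: "nat \<Rightarrow> nat \<Rightarrow> real" and f :: "nat \<Rightarrow> real"
  assumes sub: "\<And>n m k. c (n + m) k \<le> c n k + c m (k + n)"
    and f: "\<And>k. c 1 k \<le> f k" "\<And>k. f k \<ge> 0"
  shows "real m * c (n + m) 0 \<le> (\<Sum>i<m. c i 0) + (\<Sum>k<n. c m k) + real m * (\<Sum>j<m. f (n + j))"
proof -
  have W: "(\<Sum>i<m. c (n + i) 0) \<le> (\<Sum>i<m. c i 0) + (\<Sum>k<n. c m k)"
  proof (induction n)
    case (Suc n)
    have "(\<Sum>i<m. c (Suc n + i) 0) + c n 0 = (\<Sum>i<Suc m. c (n + i) 0)"
      by (subst sum.lessThan_Suc_shift) simp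
    also have "\<dots> = (\<Sum>i<m. c (n + i) 0) + c (n + m) 0" by simp
    also have "c (n + m) 0 \<le> c n 0 + c m n" using sub[of n m 0] by simp
    finally show ?case using Suc by simp
  qed simp
  have extend: "c (k + q) 0 \<le> c k 0 + (\<Sum>j<q. f (k + j))" for k q
  proof (induction q)
    case (Suc q)
    have "c (k + Suc q) 0 \<le> c (k + q) 0 + c 1 (k + q)" using sub[of "k + q" 1 0] by simp
    then show ?case using Suc f(1)[of "k + q"] by simp
  qed simp
  have "c (n + m) 0 \<le> c (n + i) 0 + (\<Sum>j<m. f (n + j))" if "i < m" for i
  proof -
    have "(\<Sum>j<m - i. f (n + i + j)) = (\<Sum>j=i..<m. f (n + j))"
      using sum.shift_bounds_nat_ivl[of "\<lambda>j. f (n + j)" 0 i "m - i"] that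
      by (simp add: lessThan_atLeast0 ac_simps)
    also have "\<dots> \<le> (\<Sum>j<m. f (n + j))"
      using f(2) by (intro sum_mono2) auto
    finally show ?thesis using extend[of "n + i" "m - i"] that by simp
  qed
  then have "(\<Sum>i<m. c (n + m) 0) \<le> (\<Sum>i<m. c (n + i) 0 + (\<Sum>j<m. f (n + j)))"
    by (intro sum_mono) auto
  with W show ?thesis by (simp add: sum.distrib)
qed

context conservative_weighted
begin

text \<open>Up to terms of the form \<open>u ((T ^^ (n + i)) x)\<close> with \<open>i < m\<close>, which the Chacon--Ornstein lemma makes
negligible, \<open>m * b (n + m)\<close> is bounded by the Birkhoff sum of \<open>b m\<close>.\<close>

lemma limsup_ratio_le:
  assumes int: "\<And>n. integrable M (b n)"
    and sub: "AE x in M. \<forall>n m. b (n + m) x \<le> b n x + b m ((T ^^ n) x)"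
    and "m \<ge> 1"
    and lim: "AE x in M. (\<lambda>n. birkhoff_sum T (b m) n x / G n x) \<longlonglongrightarrow> c x"
  shows "AE x in M. limsup (\<lambda>n. ereal (b n x / G n x)) \<le> ereal (c x / real m)"
proof -
  define u where "u x = \<bar>b 1 x\<bar> + \<bar>b m x\<bar>" for x
  have "AE x in M. (\<lambda>n. u ((T ^^ n) x) / G n x) \<longlonglongrightarrow> 0"
    by (rule iterate_over_weight_tendsto_0) (use int in \<open>auto simp: u_def[abs_def]\<close>)
  then show ?thesis
    using AE_orbit[OF sub] lim weight_diverges
  proof eventually_elim
    case (elim x)
    define W where "W = (\<Sum>i<m. b i x)"
    define r where "r n = (W / G (n + m) x + birkhoff_sum T (b m) (n + m) x / G (n + m) x
        + real m * (\<Sum>i<m. u ((T ^^ (n + i)) x) / G (n + i) x)) / real m" for n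
    have r1: "(\<lambda>n. W / G (n + m) x) \<longlonglongrightarrow> 0"
      by (rule LIMSEQ_ignore_initial_segment)
         (intro tendsto_divide_0[OF tendsto_const] filterlim_at_top_imp_at_infinity elim(4))
    have r2: "(\<lambda>n. birkhoff_sum T (b m) (n + m) x / G (n + m) x) \<longlonglongrightarrow> c x"
      using LIMSEQ_ignore_initial_segment[OF elim(3)] .
    have r3: "(\<lambda>n. \<Sum>i<m. u ((T ^^ (n + i)) x) / G (n + i) x) \<longlonglongrightarrow> (\<Sum>i<m. 0)"
      by (intro tendsto_sum LIMSEQ_ignore_initial_segment[OF elim(1)])
    have "r \<longlonglongrightarrow> (0 + c x + real m * (\<Sum>i<m. 0)) / real m"
      unfolding r_def
      by (rule tendsto_divide[OF tendsto_add[OF tendsto_add[OF r1 r2] tendsto_mult[OF tendsto_const r3]] tendsto_const])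
         (use \<open>m \<ge> 1\<close> in simp)
    then have r: "(\<lambda>n. ereal (r n)) \<longlonglongrightarrow> ereal (c x / real m)" by simp
    have "limsup (\<lambda>n. ereal (b n x / G n x)) = limsup (\<lambda>n. ereal (b (n + m) x / G (n + m) x))"
      by (rule limsup_shift_k[symmetric])
    also have "\<dots> \<le> limsup (\<lambda>n. ereal (r n))"
    proof (rule Limsup_mono, rule eventually_mono[OF eventually_ge_at_top[of "1::nat"]])
      fix n :: nat assume n: "1 \<le> n"
      have Gp: "G (n + m) x > 0" using n by (intro G_pos) simp
      have avg: "real m * b (n + m) ((T ^^ 0) x) \<le> (\<Sum>i<m. b i ((T ^^ 0) x)) + (\<Sum>k<n. b m ((T ^^ k) x))
          + real m * (\<Sum>j<m. \<bar>b 1 ((T ^^ (n + j)) x)\<bar>)"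
      proof (rule subadditive_averaging[where c = "\<lambda>n k. b n ((T ^^ k) x)" and f = "\<lambda>k. \<bar>b 1 ((T ^^ k) x)\<bar>"])
        show "b (n + m) ((T ^^ k) x) \<le> b n ((T ^^ k) x) + b m ((T ^^ (k + n)) x)" for n m k
          using elim(2) by (simp add: add.commute[of k n] funpow_add)
      qed auto
      have split: "(\<Sum>k<n. b m ((T ^^ k) x)) = birkhoff_sum T (b m) (n + m) x - (\<Sum>i<m. b m ((T ^^ (n + i)) x))"
        by (simp add: birkhoff_sum_add) (simp add: birkhoff_sum_def funpow_add add.commute[of n])
      have ends: "- (\<Sum>i<m. b m ((T ^^ (n + i)) x)) \<le> real m * (\<Sum>i<m. \<bar>b m ((T ^^ (n + i)) x)\<bar>)"
      proof -
        have "- (\<Sum>i<m. b m ((T ^^ (n + i)) x)) \<le> 1 * (\<Sum>i<m. \<bar>b m ((T ^^ (n + i)) x)\<bar>)"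
          by (simp flip: sum_negf) (intro sum_mono, simp)
        also have "\<dots> \<le> real m * (\<Sum>i<m. \<bar>b m ((T ^^ (n + i)) x)\<bar>)"
          using \<open>m \<ge> 1\<close> by (intro mult_right_mono sum_nonneg) auto
        finally show ?thesis .
      qed
      have "real m * (\<Sum>i<m. u ((T ^^ (n + i)) x)) =
          real m * (\<Sum>j<m. \<bar>b 1 ((T ^^ (n + j)) x)\<bar>) + real m * (\<Sum>i<m. \<bar>b m ((T ^^ (n + i)) x)\<bar>)"
        by (simp add: u_def sum.distrib distrib_left)
      with avg ends have "real m * b (n + m) x \<le> W + birkhoff_sum T (b m) (n + m) x
          + real m * (\<Sum>i<m. u ((T ^^ (n + i)) x))"
        unfolding split W_def by simp
      then have "real m * b (n + m) x / G (n + m) x \<le> (W + birkhoff_sum T (b m) (n + m) x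
          + real m * (\<Sum>i<m. u ((T ^^ (n + i)) x))) / G (n + m) x"
        using Gp by (intro divide_right_mono) auto
      also have "\<dots> = W / G (n + m) x + birkhoff_sum T (b m) (n + m) x / G (n + m) x
          + real m * (\<Sum>i<m. u ((T ^^ (n + i)) x) / G (n + m) x)"
        by (simp add: add_divide_distrib flip: sum_divide_distrib)
      also have "\<dots> \<le> r n * real m"
      proof -
        have "(\<Sum>i<m. u ((T ^^ (n + i)) x) / G (n + m) x) \<le> (\<Sum>i<m. u ((T ^^ (n + i)) x) / G (n + i) x)"
          using n by (intro sum_mono divide_left_mono G_mono mult_pos_pos G_pos) (auto simp: u_def)
        then show ?thesis using \<open>m \<ge> 1\<close> by (simp add: r_def mult_left_mono)
      qed
      finally show "ereal (b (n + m) x / G (n + m) x) \<le> ereal (r n)"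
        using \<open>m \<ge> 1\<close> mult_le_cancel_left_pos[of "real m" "b (n + m) x / G (n + m) x" "r n"]
        by (simp add: mult.commute)
    qed
    also have "\<dots> = ereal (c x / real m)"
      using r by (intro lim_imp_Limsup) auto
    finally show ?case .
  qed
qed

text \<open>Let \<open>V \<le> U\<close> be the lower and upper limits of the ratios. Comparison with the Birkhoff sums of
\<open>b m\<close> bounds the weighted integral of \<open>U\<close> by the mean \<open>(\<integral>x. b m x \<partial>M) / m\<close> for every
\<open>m\<close>, while the covering argument bounds the upper limit of these means by the weighted integral of
\<open>V\<close>. Everything coincides. The lower bound on \<open>b\<close> makes all these integrals finite.\<close>

theorem subadditive_ratio_bounded_below:
  assumes int: "\<And>n. integrable M (b n)" and zero: "\<And>x. b 0 x = 0"
    and sub: "AE x in M. \<forall>n m. b (n + m) x \<le> b n x + b m ((T ^^ n) x)"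
    and lower: "AE x in M. \<forall>n. - L * G n x \<le> b n x" and "L \<ge> 0"
  shows "\<exists>\<psi>\<in>borel_measurable M. (AE x in M. (\<lambda>n. b n x / G n x) \<longlonglongrightarrow> \<psi> x) \<and>
    integrable M (\<lambda>x. \<psi> x * g x) \<and>
    (\<forall>m\<ge>1. (\<integral>x. \<psi> x * g x \<partial>M) \<le> (\<integral>x. b m x \<partial>M) / real m) \<and>
    (\<lambda>n. (\<integral>x. b n x \<partial>M) / real n) \<longlonglongrightarrow> (\<integral>x. \<psi> x * g x \<partial>M)"
proof -
  define U where "U x = limsup (\<lambda>n. ereal (b n x / G n x))" for x
  define V where "V x = liminf (\<lambda>n. ereal (b n x / G n x))" for x
  have [measurable]: "b n \<in> borel_measurable M" for n using int by simp
  have [measurable]: "U \<in> borel_measurable M" unfolding U_def by measurable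
  have [measurable]: "V \<in> borel_measurable M" unfolding V_def by measurable
  have "\<forall>m. \<exists>c. c \<in> borel_measurable M \<and> (AE x in M. (\<lambda>n. birkhoff_sum T (b m) n x / G n x) \<longlonglongrightarrow> c x) \<and>
    integrable M (\<lambda>x. c x * g x) \<and> (\<integral>x. c x * g x \<partial>M) = (\<integral>x. b m x \<partial>M)"
    using ratio_ergodic[OF int] by blast
  from choice[OF this] obtain c where c_meas: "\<And>m. c m \<in> borel_measurable M"
    and c_lim: "\<And>m. AE x in M. (\<lambda>n. birkhoff_sum T (b m) n x / G n x) \<longlonglongrightarrow> c m x"
    and c_int: "\<And>m. integrable M (\<lambda>x. c m x * g x)"
    and c_integral: "\<And>m. (\<integral>x. c m x * g x \<partial>M) = (\<integral>x. b m x \<partial>M)"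
    by blast
  have U_le: "AE x in M. U x \<le> ereal (c m x / real m)" if "m \<ge> 1" for m
    unfolding U_def using that by (intro limsup_ratio_le[OF int sub _ c_lim])
  have V_ge: "AE x in M. ereal (- L) \<le> V x"
    using lower
  proof eventually_elim
    case (elim x)
    show ?case
      unfolding V_def
    proof (rule Liminf_bounded, rule eventually_mono[OF eventually_ge_at_top[of "1::nat"]])
      fix n :: nat assume "1 \<le> n"
      then show "ereal (- L) \<le> ereal (b n x / G n x)"
        using elim G_pos[of n x] by (simp add: field_simps)
    qed
  qed
  have VU: "V x \<le> U x" for x unfolding V_def U_def by (rule Liminf_le_Limsup) simp
  define u where "u x = real_of_ereal (U x)" for x
  define v where "v x = real_of_ereal (max (V x) (ereal (- L)))" for x
  have [measurable]: "u \<in> borel_measurable M" "v \<in> borel_measurable M"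
    unfolding u_def[abs_def] v_def[abs_def] by measurable
  have uv: "AE x in M. U x = ereal (u x) \<and> V x = ereal (v x) \<and> - L \<le> v x \<and> v x \<le> u x \<and> u x \<le> c 1 x"
    using U_le[of 1, simplified] V_ge
  proof eventually_elim
    case (elim x)
    then show ?case using VU[of x] unfolding u_def v_def
      by (cases "U x"; cases "V x") (auto simp: max_absorb1)
  qed
  have int_w: "integrable M (\<lambda>x. w x * g x)"
    if [measurable]: "w \<in> borel_measurable M" and w: "AE x in M. - L \<le> w x \<and> w x \<le> c 1 x" for w
  proof (rule Bochner_Integration.integrable_bound[of M "\<lambda>x. \<bar>c 1 x * g x\<bar> + L * g x"])
    show "integrable M (\<lambda>x. \<bar>c 1 x * g x\<bar> + L * g x)"
      using c_int integrable_weight by auto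
    show "AE x in M. norm (w x * g x) \<le> norm (\<bar>c 1 x * g x\<bar> + L * g x)"
      using w
    proof eventually_elim
      case (elim x)
      then have "\<bar>w x\<bar> \<le> \<bar>c 1 x\<bar> + L" using \<open>L \<ge> 0\<close> by auto
      then have "\<bar>w x\<bar> * g x \<le> (\<bar>c 1 x\<bar> + L) * g x"
        by (intro mult_right_mono weight_nonneg)
      then show ?case using weight_nonneg[of x] \<open>L \<ge> 0\<close>
        by (simp add: abs_mult algebra_simps)
    qed
  qed simp
  have int_u: "integrable M (\<lambda>x. u x * g x)"
    by (rule int_w, measurable) (use uv in eventually_elim, auto)
  have int_v: "integrable M (\<lambda>x. v x * g x)"
    by (rule int_w, measurable) (use uv in eventually_elim, auto)
  have u_le: "(\<integral>x. u x * g x \<partial>M) \<le> (\<integral>x. b m x \<partial>M) / real m" if "m \<ge> 1" for m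
  proof -
    have "(\<integral>x. u x * g x \<partial>M) \<le> (\<integral>x. c m x * g x / real m \<partial>M)"
    proof (rule integral_mono_AE)
      show "AE x in M. u x * g x \<le> c m x * g x / real m"
        using uv U_le[OF that]
      proof eventually_elim
        case (elim x)
        then have "u x \<le> c m x / real m" by simp
        then have "u x * g x \<le> c m x / real m * g x"
          by (intro mult_right_mono weight_nonneg)
        then show ?case by simp
      qed
    qed (use int_u c_int in auto)
    then show ?thesis by (simp add: c_integral)
  qed
  have ev: "eventually (\<lambda>K. (\<integral>x. b K x \<partial>M) / real K \<le> (\<integral>x. v x * g x \<partial>M) + e) sequentially" if "e > 0" for e
  proof (rule eventually_mean_le_integral_liminf[where L = L, OF int zero sub \<open>L \<ge> 0\<close> _ _ int_v that])
    show "v x = real_of_ereal (max (liminf (\<lambda>n. ereal (b n x / G n x))) (ereal (- L)))" for x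
      by (simp add: v_def V_def)
    show "AE x in M. liminf (\<lambda>n. ereal (b n x / G n x)) < \<infinity>"
      using uv unfolding V_def[symmetric] by eventually_elim auto
  qed
  have le_v: "(\<integral>x. u x * g x \<partial>M) \<le> (\<integral>x. v x * g x \<partial>M)"
  proof (rule field_le_epsilon)
    fix e :: real assume "e > 0"
    then obtain K :: nat where "K \<ge> 1" "(\<integral>x. b K x \<partial>M) / real K \<le> (\<integral>x. v x * g x \<partial>M) + e"
      using ev[of e] unfolding eventually_sequentially by (metis linear)
    then show "(\<integral>x. u x * g x \<partial>M) \<le> (\<integral>x. v x * g x \<partial>M) + e"
      using u_le[of K] by simp
  qed
  have vu: "AE x in M. v x = u x"
    by (rule AE_eq_if_weighted_integral_le[OF _ int_v int_u le_v]) (use uv in eventually_elim, simp)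
  then have "AE x in M. (\<lambda>n. b n x / G n x) \<longlonglongrightarrow> u x"
    using uv
  proof eventually_elim
    case (elim x)
    then have "(\<lambda>n. ereal (b n x / G n x)) \<longlonglongrightarrow> ereal (u x)"
      unfolding U_def V_def by (intro Liminf_eq_Limsup) auto
    then show ?case by simp
  qed
  moreover have "(\<lambda>n. (\<integral>x. b n x \<partial>M) / real n) \<longlonglongrightarrow> (\<integral>x. u x * g x \<partial>M)"
  proof (rule tendstoI)
    fix e :: real assume "e > 0"
    have vu_int: "(\<integral>x. v x * g x \<partial>M) = (\<integral>x. u x * g x \<partial>M)"
      by (rule integral_cong_AE) (measurable, use vu in eventually_elim, simp)
    show "eventually (\<lambda>n. dist ((\<integral>x. b n x \<partial>M) / real n) (\<integral>x. u x * g x \<partial>M) < e) sequentially"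
      using ev[OF half_gt_zero[OF \<open>e > 0\<close>]] eventually_ge_at_top[of "1::nat"]
    proof eventually_elim
      case (elim n)
      then show ?case using u_le[of n] \<open>e > 0\<close> by (simp add: vu_int dist_real_def abs_if)
    qed
  qed
  ultimately show ?thesis using int_u u_le by (intro bexI[of _ u]) auto
qed

end

section \<open>Truncation and the extended real integral\<close>

lemma ereal_LIMSEQ_of_truncations:
  fixes u v :: "nat \<Rightarrow> ereal"
  assumes "\<And>L. (\<lambda>n. max (u n) (ereal (- real L))) \<longlonglongrightarrow> v L"
  shows "u \<longlonglongrightarrow> (INF L. v L)"
proof (rule order_tendstoI)
  fix y assume y: "y < (INF L. v L)"
  then obtain z where z: "y < ereal z" "ereal z < (INF L. v L)" by (rule ereal_dense2[elim_format]) blast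
  obtain L :: nat where "- z < real L" using reals_Archimedean2 by blast
  have "ereal z < v L" using z(2) INF_lower[of L UNIV v] by simp
  with assms[of L] have "eventually (\<lambda>n. ereal z < max (u n) (ereal (- real L))) sequentially"
    by (rule order_tendstoD(1))
  then show "eventually (\<lambda>n. y < u n) sequentially"
  proof eventually_elim
    case (elim n)
    then have "ereal z < u n" using \<open>- z < real L\<close> by (auto simp: less_max_iff_disj)
    with z(1) show ?case by (rule less_trans)
  qed
next
  fix y assume "(INF L. v L) < y"
  then obtain L where "v L < y" by (auto simp: INF_less_iff)
  with assms[of L] have "eventually (\<lambda>n. max (u n) (ereal (- real L)) < y) sequentially"
    by (rule order_tendstoD(2))
  then show "eventually (\<lambda>n. u n < y) sequentially" by eventually_elim simp
qed

lemma pos_part_integrable_cong_AE: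
  assumes "AE x in M. \<phi> x = \<psi> x" "pos_part_integrable M \<phi>" "\<psi> \<in> borel_measurable M"
  shows "pos_part_integrable M \<psi>"
proof -
  have "(\<integral>\<^sup>+x. e2ennreal (max (\<psi> x) 0) \<partial>M) = (\<integral>\<^sup>+x. e2ennreal (max (\<phi> x) 0) \<partial>M)"
    by (rule nn_integral_cong_AE) (use assms(1) in eventually_elim, simp)
  then show ?thesis using assms by (simp add: pos_part_integrable_def)
qed

lemma pos_part_integrable_mono_AE:
  assumes "AE x in M. \<phi> x \<le> \<psi> x" "pos_part_integrable M \<psi>" "\<phi> \<in> borel_measurable M"
  shows "pos_part_integrable M \<phi>"
proof -
  have "(\<integral>\<^sup>+x. e2ennreal (max (\<phi> x) 0) \<partial>M) \<le> (\<integral>\<^sup>+x. e2ennreal (max (\<psi> x) 0) \<partial>M)"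
    by (rule nn_integral_mono_AE) (use assms(1) in eventually_elim, auto intro!: e2ennreal_mono max.mono)
  then show ?thesis using assms by (auto simp: pos_part_integrable_def intro: order_le_less_trans)
qed

lemma ereal_integral_cong_AE:
  assumes "AE x in M. \<phi> x = \<psi> x"
  shows "ereal_integral M \<phi> = ereal_integral M \<psi>"
proof -
  have "(\<integral>\<^sup>+x. e2ennreal (max (\<phi> x) 0) \<partial>M) = (\<integral>\<^sup>+x. e2ennreal (max (\<psi> x) 0) \<partial>M)"
    by (rule nn_integral_cong_AE) (use assms in eventually_elim, simp)
  moreover have "(\<integral>\<^sup>+x. e2ennreal (max (- \<phi> x) 0) \<partial>M) = (\<integral>\<^sup>+x. e2ennreal (max (- \<psi> x) 0) \<partial>M)"
    by (rule nn_integral_cong_AE) (use assms in eventually_elim, simp)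
  ultimately show ?thesis by (simp add: ereal_integral_def)
qed

lemma pos_part_integrable_ereal:
  assumes "integrable M f"
  shows "pos_part_integrable M (\<lambda>x. ereal (f x))"
proof -
  have "e2ennreal (max (ereal (f x)) 0) = ennreal (f x)" for x
    by (cases "f x \<ge> 0") (auto simp: max_def ennreal_neg e2ennreal_neg)
  moreover have "(\<integral>\<^sup>+x. ennreal (f x) \<partial>M) < \<infinity>"
    using assms by (simp add: real_integrable_def less_top)
  moreover have "f \<in> borel_measurable M" using assms by simp
  ultimately show ?thesis
    by (simp add: pos_part_integrable_def)
qed

lemma pos_part_integrable_less_top:
  assumes "pos_part_integrable M \<phi>"
  shows "AE x in M. \<phi> x < \<infinity>"
proof -
  have "AE x in M. e2ennreal (max (\<phi> x) 0) \<noteq> \<infinity>"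
    using assms unfolding pos_part_integrable_def by (intro nn_integral_PInf_AE) auto
  then show ?thesis
  proof eventually_elim
    case (elim x)
    then show ?case by (cases "\<phi> x") auto
  qed
qed

lemma ereal_integral_less_top:
  assumes "pos_part_integrable M \<phi>"
  shows "ereal_integral M \<phi> < \<infinity>"
proof -
  define P where "P = (\<integral>\<^sup>+x. e2ennreal (max (\<phi> x) 0) \<partial>M)"
  define Q where "Q = (\<integral>\<^sup>+x. e2ennreal (max (- \<phi> x) 0) \<partial>M)"
  have "P < \<infinity>" using assms by (simp add: P_def pos_part_integrable_def)
  then have "enn2ereal P < \<infinity>" by (cases P) auto
  moreover have "0 \<le> enn2ereal Q" by simp
  ultimately have "enn2ereal P - enn2ereal Q < \<infinity>"
    by (cases "enn2ereal P"; cases "enn2ereal Q") auto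
  then show ?thesis by (simp add: ereal_integral_def P_def Q_def)
qed

text \<open>Truncation from below leaves the positive part untouched and replaces the negative part \<open>q\<close> by
\<open>min q (L * w)\<close>, which increases to \<open>q\<close>.\<close>

lemma ereal_integral_truncation:
  fixes w :: "'a \<Rightarrow> real"
  assumes \<phi>: "pos_part_integrable M \<phi>" and w: "integrable M w" "\<And>x. w x > 0"
  defines "F \<equiv> \<lambda>L x. real_of_ereal (max (\<phi> x) (ereal (- (real L * w x))))"
  shows "integrable M (F L)"
    and "ereal_integral M \<phi> \<le> ereal (\<integral>x. F L x \<partial>M)"
    and "(\<lambda>L. ereal (\<integral>x. F L x \<partial>M)) \<longlonglongrightarrow> ereal_integral M \<phi>"
proof -
  have [measurable]: "\<phi> \<in> borel_measurable M" using \<phi> by (simp add: pos_part_integrable_def)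
  have [measurable]: "w \<in> borel_measurable M" using w by simp
  have [measurable]: "F L \<in> borel_measurable M" for L unfolding F_def by measurable
  define P where "P = (\<integral>\<^sup>+x. e2ennreal (max (\<phi> x) 0) \<partial>M)"
  define q where "q x = e2ennreal (max (- \<phi> x) 0)" for x
  define Q where "Q L = (\<integral>\<^sup>+x. min (q x) (ennreal (real L * w x)) \<partial>M)" for L :: nat
  have [measurable]: "q \<in> borel_measurable M" unfolding q_def[abs_def] by measurable
  have P_fin: "P < \<infinity>" using \<phi> by (simp add: P_def pos_part_integrable_def)
  have parts: "AE x in M. ennreal (F L x) = e2ennreal (max (\<phi> x) 0) \<and>
      ennreal (- F L x) = min (q x) (ennreal (real L * w x))" for L
    using pos_part_integrable_less_top[OF \<phi>]
  proof eventually_elim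
    case (elim x)
    have nn: "0 \<le> real L * w x" using w(2)[of x] by simp
    show ?case
    proof (cases "\<phi> x")
      case (real r)
      then have "F L x = max r (- (real L * w x))" by (simp add: F_def max_def)
      then show ?thesis using real nn
        by (cases "r \<ge> 0"; cases "r \<ge> - (real L * w x)")
           (auto simp: q_def max_def min_def ennreal_neg e2ennreal_neg)
    qed (use elim nn in \<open>auto simp: F_def q_def max_def ennreal_neg e2ennreal_neg\<close>)
  qed
  have F_pos: "(\<integral>\<^sup>+x. ennreal (F L x) \<partial>M) = P" for L
    unfolding P_def by (rule nn_integral_cong_AE) (use parts[of L] in eventually_elim, simp)
  have F_neg: "(\<integral>\<^sup>+x. ennreal (- F L x) \<partial>M) = Q L" for L
    unfolding Q_def by (rule nn_integral_cong_AE) (use parts[of L] in eventually_elim, simp)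
  have Q_fin: "Q L < \<infinity>" for L
  proof -
    have "Q L \<le> (\<integral>\<^sup>+x. ennreal (real L * w x) \<partial>M)"
      unfolding Q_def by (intro nn_integral_mono) auto
    also have "\<dots> < \<infinity>"
    proof -
      have "integrable M (\<lambda>x. real L * w x)" using w(1) by simp
      then have "(\<integral>\<^sup>+x. ennreal (real L * w x) \<partial>M) \<noteq> \<infinity>"
        unfolding real_integrable_def by blast
      then show ?thesis by (simp add: less_top)
    qed
    finally show ?thesis .
  qed
  show int: "integrable M (F L)" for L
    unfolding real_integrable_def F_pos F_neg using P_fin Q_fin[of L] by auto
  have F_int: "ereal (\<integral>x. F L x \<partial>M) = enn2ereal P - enn2ereal (Q L)" for L
    unfolding real_lebesgue_integral_def[OF int] F_pos F_neg
    using P_fin Q_fin[of L] by (cases P; cases "Q L") auto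
  have integral_eq: "ereal_integral M \<phi> = enn2ereal P - enn2ereal (\<integral>\<^sup>+x. q x \<partial>M)"
    by (simp add: ereal_integral_def P_def q_def)
  have "Q L \<le> (\<integral>\<^sup>+x. q x \<partial>M)"
    unfolding Q_def by (intro nn_integral_mono) auto
  then show "ereal_integral M \<phi> \<le> ereal (\<integral>x. F L x \<partial>M)"
    unfolding F_int integral_eq by (intro ereal_minus_mono) (auto simp: less_eq_ennreal.rep_eq)
  have "Q \<longlonglongrightarrow> (\<integral>\<^sup>+x. q x \<partial>M)"
    unfolding Q_def[abs_def]
  proof (rule nn_integral_LIMSEQ)
    have le: "ennreal (real L * w x) \<le> ennreal (real L' * w x)" if "L \<le> L'" for L L' x
      using that w(2)[of x] by (intro ennreal_leI mult_right_mono) auto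
    then show "incseq (\<lambda>L x. min (q x) (ennreal (real L * w x)))"
      by (auto simp: incseq_def le_fun_def intro: min.coboundedI2)
    show "(\<lambda>L. min (q x) (ennreal (real L * w x))) \<longlonglongrightarrow> q x" for x
    proof -
      have "(SUP L. ennreal (real L * w x)) = top"
      proof (rule ennreal_SUP_eq_top)
        fix n :: nat
        obtain L :: nat where "real n / w x < real L" using reals_Archimedean2 by blast
        then have "real n \<le> real L * w x" using w(2)[of x] by (simp add: field_simps)
        then have "of_nat n \<le> ennreal (real L * w x)"
          by (metis ennreal_leI ennreal_of_nat_eq_real_of_nat)
        then show "\<exists>L\<in>UNIV. of_nat n \<le> ennreal (real L * w x)" by blast
      qed
      moreover have "(\<lambda>L. ennreal (real L * w x)) \<longlonglongrightarrow> (SUP L. ennreal (real L * w x))"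
        using le by (intro LIMSEQ_SUP) (auto simp: incseq_def)
      ultimately have "(\<lambda>L. min (q x) (ennreal (real L * w x))) \<longlonglongrightarrow> min (q x) top"
        by (intro tendsto_min tendsto_const) (simp only:)
      then show ?thesis by simp
    qed
  qed simp
  then have "(\<lambda>L. enn2ereal P - enn2ereal (Q L)) \<longlonglongrightarrow> enn2ereal P - enn2ereal (\<integral>\<^sup>+x. q x \<partial>M)"
    using P_fin by (intro tendsto_diff_ereal_general tendsto_const tendsto_enn2erealI) auto
  then show "(\<lambda>L. ereal (\<integral>x. F L x \<partial>M)) \<longlonglongrightarrow> ereal_integral M \<phi>"
    by (simp only: F_int integral_eq)
qed

section \<open>Subadditive sequences with values in the extended reals\<close>

context conservative_weighted
begin

text \<open>The maximum of a subadditive sequence and the additive sequence \<open>- L * G n\<close> is again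
subadditive, and it is bounded below. Its ratios are the ratios of \<open>a\<close> truncated at \<open>- L\<close>, so
letting \<open>L\<close> tend to infinity recovers \<open>a\<close>: pointwise for the limit, and by monotone
convergence for the integrals.\<close>

theorem subadditive_ratio:
  fixes a :: "nat \<Rightarrow> 'a \<Rightarrow> ereal"
  assumes meas: "\<And>n. n \<ge> 1 \<Longrightarrow> a n \<in> borel_measurable M"
    and sub: "subadditive_seq M T a"
    and pos: "pos_part_integrable M (a 1)"
  shows "\<exists>h\<in>borel_measurable M.
    (AE x in M. h x < \<infinity> \<and> (\<lambda>n. a n x / ereal (G n x)) \<longlonglongrightarrow> h x) \<and>
    (\<forall>n\<ge>1. pos_part_integrable M (a n)) \<and>
    pos_part_integrable M (\<lambda>x. h x * ereal (g x)) \<and>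
    (\<forall>n\<ge>1. ereal_integral M (\<lambda>x. h x * ereal (g x)) \<le> ereal (1 / real n) * ereal_integral M (a n)) \<and>
    (\<lambda>n. ereal (1 / real n) * ereal_integral M (a n)) \<longlonglongrightarrow> ereal_integral M (\<lambda>x. h x * ereal (g x))"
proof -
  \<comment> \<open>A finite version of the positive part of \<open>a 1\<close>; its Birkhoff sums dominate \<open>a\<close>.\<close>
  define f where "f x = enn2real (e2ennreal (max (a 1 x) 0))" for x
  have [measurable]: "a (Suc n) \<in> borel_measurable M" for n by (rule meas) simp
  have [measurable]: "a 1 \<in> borel_measurable M" by (rule meas) simp
  have [measurable]: "f \<in> borel_measurable M" unfolding f_def[abs_def] by measurable
  have f_eq: "AE x in M. ennreal (f x) = e2ennreal (max (a 1 x) 0) \<and> a 1 x \<le> ereal (f x)"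
    using pos_part_integrable_less_top[OF pos]
  proof eventually_elim
    case (elim x)
    then show ?case by (cases "a 1 x") (auto simp: f_def max_def e2ennreal_neg)
  qed
  have "(\<integral>\<^sup>+x. ennreal (f x) \<partial>M) = (\<integral>\<^sup>+x. e2ennreal (max (a 1 x) 0) \<partial>M)"
    by (rule nn_integral_cong_AE) (use f_eq in eventually_elim, simp)
  then have int_f: "integrable M f"
    using pos by (intro integrableI_nonneg) (auto simp: pos_part_integrable_def f_def)
  have sub_AE: "AE x in M. \<forall>n\<ge>1. \<forall>m\<ge>1. a (n + m) x \<le> a n x + a m ((T ^^ n) x)"
    using sub unfolding subadditive_seq_def by (simp add: AE_all_countable)
  have a_le: "AE x in M. \<forall>n\<ge>1. a n x \<le> ereal (birkhoff_sum T f n x)"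
    using AE_orbit[OF f_eq] sub_AE
  proof eventually_elim
    case (elim x)
    show ?case
    proof (intro allI impI)
      fix n :: nat assume "1 \<le> n"
      then show "a n x \<le> ereal (birkhoff_sum T f n x)"
      proof (induction n rule: dec_induct)
        case base
        show ?case using elim(1)[rule_format, of 0] by (simp add: birkhoff_sum_def)
      next
        case (step n)
        have "a (Suc n) x \<le> a n x + a 1 ((T ^^ n) x)"
          using elim(2)[rule_format, of n 1] step by simp
        also have "\<dots> \<le> ereal (birkhoff_sum T f n x) + ereal (f ((T ^^ n) x))"
          using step elim(1)[rule_format, of n] by (intro add_mono) auto
        also have "\<dots> = ereal (birkhoff_sum T f (Suc n) x)"
          by (simp add: birkhoff_sum_def)
        finally show ?case .
      qed
    qed
  qed
  have pos_a: "pos_part_integrable M (a n)" if "n \<ge> 1" for n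
    by (rule pos_part_integrable_mono_AE[OF _ pos_part_integrable_ereal[OF integrable_birkhoff_sum[OF int_f, of n]] meas[OF that]])
       (use a_le in eventually_elim, use that in blast)

  \<comment> \<open>The value \<open>0\<close> at index \<open>0\<close> extends subadditivity to all indices.\<close>
  define b where "b L n x = (if n = 0 then 0 else real_of_ereal (max (a n x) (ereal (- (real L * G n x)))))"
    for L n :: nat and x
  have b_trunc: "b L n = (\<lambda>x. real_of_ereal (max (a n x) (ereal (- (real L * G n x)))))" if "n \<ge> 1" for L n
    using that by (auto simp: b_def)
  note trunc_a = ereal_integral_truncation[OF pos_a integrable_birkhoff_sum[OF integrable_weight] G_pos]
  have int_b: "integrable M (b L n)" for L n
    by (cases "n = 0") (auto simp: b_def[abs_def] intro!: trunc_a(1))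
  have b_eq: "AE x in M. \<forall>k. \<forall>L. \<forall>n\<ge>1. ereal (b L n ((T ^^ k) x)) = max (a n ((T ^^ k) x)) (ereal (- (real L * G n ((T ^^ k) x))))"
  proof (rule AE_orbit)
    show "AE x in M. \<forall>L. \<forall>n\<ge>1. ereal (b L n x) = max (a n x) (ereal (- (real L * G n x)))"
      using a_le
    proof eventually_elim
      case (elim x)
      show ?case
      proof (intro allI impI)
        fix L n :: nat assume "1 \<le> n"
        with elim show "ereal (b L n x) = max (a n x) (ereal (- (real L * G n x)))"
          by (cases "a n x") (auto simp: b_def max_def)
      qed
    qed
  qed
  have sub_b: "AE x in M. \<forall>n m. b L (n + m) x \<le> b L n x + b L m ((T ^^ n) x)" for L
    using b_eq sub_AE
  proof eventually_elim
    case (elim x)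
    show ?case
    proof (intro allI)
      fix n m :: nat
      consider "n = 0" | "m = 0" | "n \<ge> 1" "m \<ge> 1" by linarith
      then show "b L (n + m) x \<le> b L n x + b L m ((T ^^ n) x)"
      proof cases
        case 3
        have "ereal (b L (n + m) x) = max (a (n + m) x) (ereal (- (real L * G (n + m) x)))"
          using elim(1)[rule_format, of "n + m" L 0] 3 by simp
        also have "\<dots> \<le> ereal (b L n x) + ereal (b L m ((T ^^ n) x))"
        proof (rule max.boundedI)
          have "a (n + m) x \<le> a n x + a m ((T ^^ n) x)" using elim(2) 3 by blast
          also have "\<dots> \<le> ereal (b L n x) + ereal (b L m ((T ^^ n) x))"
            using elim(1)[rule_format, of n L 0] elim(1)[rule_format, of m L n] 3 by (intro add_mono) auto
          finally show "a (n + m) x \<le> ereal (b L n x) + ereal (b L m ((T ^^ n) x))" .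
          have "ereal (- (real L * G (n + m) x)) = ereal (- (real L * G n x)) + ereal (- (real L * G m ((T ^^ n) x)))"
            by (simp add: birkhoff_sum_add distrib_left)
          also have "\<dots> \<le> ereal (b L n x) + ereal (b L m ((T ^^ n) x))"
            using elim(1)[rule_format, of n L 0] elim(1)[rule_format, of m L n] 3 by (intro add_mono) auto
          finally show "ereal (- (real L * G (n + m) x)) \<le> ereal (b L n x) + ereal (b L m ((T ^^ n) x))" .
        qed
        finally show ?thesis by simp
      qed (simp_all add: b_def)
    qed
  qed
  have lower_b: "AE x in M. \<forall>n. - real L * G n x \<le> b L n x" for L
    using b_eq
  proof eventually_elim
    case (elim x)
    show ?case
    proof
      fix n
      show "- real L * G n x \<le> b L n x"
      proof (cases "n = 0")
        case False
        then have "ereal (- (real L * G n x)) \<le> ereal (b L n x)"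
          using elim[rule_format, of n L 0] by simp
        then show ?thesis by simp
      qed (simp add: b_def)
    qed
  qed
  have "\<forall>L. \<exists>\<psi>. \<psi> \<in> borel_measurable M \<and> (AE x in M. (\<lambda>n. b L n x / G n x) \<longlonglongrightarrow> \<psi> x) \<and>
    integrable M (\<lambda>x. \<psi> x * g x) \<and>
    (\<forall>m\<ge>1. (\<integral>x. \<psi> x * g x \<partial>M) \<le> (\<integral>x. b L m x \<partial>M) / real m) \<and>
    (\<lambda>n. (\<integral>x. b L n x \<partial>M) / real n) \<longlonglongrightarrow> (\<integral>x. \<psi> x * g x \<partial>M)"
  proof
    fix L
    show "\<exists>\<psi>. \<psi> \<in> borel_measurable M \<and> (AE x in M. (\<lambda>n. b L n x / G n x) \<longlonglongrightarrow> \<psi> x) \<and>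
      integrable M (\<lambda>x. \<psi> x * g x) \<and>
      (\<forall>m\<ge>1. (\<integral>x. \<psi> x * g x \<partial>M) \<le> (\<integral>x. b L m x \<partial>M) / real m) \<and>
      (\<lambda>n. (\<integral>x. b L n x \<partial>M) / real n) \<longlonglongrightarrow> (\<integral>x. \<psi> x * g x \<partial>M)"
      using subadditive_ratio_bounded_below[of "b L" "real L", OF int_b _ sub_b lower_b]
      by (auto simp: b_def)
  qed
  from choice[OF this] obtain \<psi> where [measurable]: "\<And>L. \<psi> L \<in> borel_measurable M"
    and \<psi>_lim: "\<And>L. AE x in M. (\<lambda>n. b L n x / G n x) \<longlonglongrightarrow> \<psi> L x"
    and \<psi>_int: "\<And>L. integrable M (\<lambda>x. \<psi> L x * g x)"
    and \<psi>_le: "\<And>L m. m \<ge> 1 \<Longrightarrow> (\<integral>x. \<psi> L x * g x \<partial>M) \<le> (\<integral>x. b L m x \<partial>M) / real m"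
    and \<psi>_mean: "\<And>L. (\<lambda>n. (\<integral>x. b L n x \<partial>M) / real n) \<longlonglongrightarrow> (\<integral>x. \<psi> L x * g x \<partial>M)"
    by blast
  define h where "h x = (INF L. ereal (\<psi> L x))" for x
  have [measurable]: "h \<in> borel_measurable M" unfolding h_def[abs_def] by measurable
  have lim_AE: "AE x in M. \<forall>L. (\<lambda>n. b L n x / G n x) \<longlonglongrightarrow> \<psi> L x"
    using \<psi>_lim by (simp add: AE_all_countable)
  have h: "AE x in M. (\<lambda>n. a n x / ereal (G n x)) \<longlonglongrightarrow> h x \<and> (\<forall>L. ereal (\<psi> L x) = max (h x) (ereal (- real L)))"
    using lim_AE b_eq
  proof eventually_elim
    case (elim x)
    note b_eq_x = elim(2)
    have trunc: "(\<lambda>n. max (a n x / ereal (G n x)) (ereal (- real L))) \<longlonglongrightarrow> ereal (\<psi> L x)" for L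
    proof -
      have "eventually (\<lambda>n. ereal (b L n x / G n x) = max (a n x / ereal (G n x)) (ereal (- real L))) sequentially"
        using eventually_ge_at_top[of "1::nat"]
      proof eventually_elim
        case (elim n)
        have Gp: "G n x > 0" using G_pos[OF elim] .
        have "ereal (b L n x) = max (a n x) (ereal (- (real L * G n x)))"
          using b_eq_x[rule_format, of n L 0] elim by simp
        then have "ereal (b L n x) / ereal (G n x) = max (a n x) (ereal (- (real L * G n x))) / ereal (G n x)"
          by simp
        also have "\<dots> = max (a n x / ereal (G n x)) (ereal (- real L))"
          using Gp by (cases "a n x") (auto simp: max_def field_simps)
        finally show ?case using Gp by simp
      qed
      moreover have "(\<lambda>n. ereal (b L n x / G n x)) \<longlonglongrightarrow> ereal (\<psi> L x)"
        using elim(1) by simp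
      ultimately show ?thesis by (rule Lim_transform_eventually[rotated])
    qed
    then have "(\<lambda>n. a n x / ereal (G n x)) \<longlonglongrightarrow> h x"
      unfolding h_def by (rule ereal_LIMSEQ_of_truncations)
    moreover from this have "(\<lambda>n. max (a n x / ereal (G n x)) (ereal (- real L))) \<longlonglongrightarrow> max (h x) (ereal (- real L))" for L
      by (intro tendsto_max tendsto_const)
    ultimately show ?case using trunc LIMSEQ_unique by blast
  qed
  have h_fin: "AE x in M. h x < \<infinity>"
    using h
  proof eventually_elim
    case (elim x)
    then have "ereal (\<psi> 0 x) = max (h x) (ereal (- real 0))" by blast
    then show ?case by (cases "h x") auto
  qed
  have pos_hg: "pos_part_integrable M (\<lambda>x. h x * ereal (g x))"
  proof (rule pos_part_integrable_mono_AE[OF _ pos_part_integrable_ereal[OF \<psi>_int[of 0]]])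
    show "AE x in M. h x * ereal (g x) \<le> ereal (\<psi> 0 x * g x)"
      using h
    proof eventually_elim
      case (elim x)
      then have "ereal (\<psi> 0 x) = max (h x) (ereal (- real 0))" by blast
      then have "h x \<le> ereal (\<psi> 0 x)" by simp
      then have "h x * ereal (g x) \<le> ereal (\<psi> 0 x) * ereal (g x)"
        by (intro ereal_mult_right_mono) (simp_all add: weight_nonneg)
      then show ?case by simp
    qed
  qed measurable
  define I where "I = ereal_integral M (\<lambda>x. h x * ereal (g x))"
  have J_lim: "(\<lambda>L. ereal (\<integral>x. \<psi> L x * g x \<partial>M)) \<longlonglongrightarrow> I"
  proof -
    have "(\<integral>x. real_of_ereal (max (h x * ereal (g x)) (ereal (- (real L * g x)))) \<partial>M) = (\<integral>x. \<psi> L x * g x \<partial>M)" for L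
    proof (rule integral_cong_AE, measurable)
      show "AE x in M. real_of_ereal (max (h x * ereal (g x)) (ereal (- (real L * g x)))) = \<psi> L x * g x"
        using h h_fin
      proof eventually_elim
        case (elim x)
        then have eq: "ereal (\<psi> L x) = max (h x) (ereal (- real L))" by blast
        show ?case
        proof (cases "h x")
          case (real r)
          then have "\<psi> L x = max r (- real L)" using eq by (simp add: max_def split: if_splits)
          then have "\<psi> L x * g x = max (r * g x) (- real L * g x)"
            using weight_nonneg by (simp add: max_mult_distrib_right)
          with real show ?thesis by (simp add: max_def)
        qed (use elim eq weight_pos[of x] in \<open>auto simp: max_def\<close>)
      qed
    qed
    then show ?thesis
      using ereal_integral_truncation(3)[OF pos_hg integrable_weight weight_pos] by (simp add: I_def)
  qed
  have b_lim: "(\<lambda>L. ereal (\<integral>x. b L n x \<partial>M)) \<longlonglongrightarrow> ereal_integral M (a n)" if "n \<ge> 1" for n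
    unfolding b_trunc[OF that] by (rule trunc_a(3)[OF that that])
  have I_le: "I \<le> ereal (1 / real n) * ereal_integral M (a n)" if "n \<ge> 1" for n
  proof (rule LIMSEQ_le[OF J_lim])
    show "(\<lambda>L. ereal (1 / real n) * ereal (\<integral>x. b L n x \<partial>M)) \<longlonglongrightarrow> ereal (1 / real n) * ereal_integral M (a n)"
      by (intro tendsto_cmult_ereal b_lim that) simp
    show "\<exists>N. \<forall>L\<ge>N. ereal (\<integral>x. \<psi> L x * g x \<partial>M) \<le> ereal (1 / real n) * ereal (\<integral>x. b L n x \<partial>M)"
      using \<psi>_le[OF that] by simp
  qed
  have "(\<lambda>n. ereal (1 / real n) * ereal_integral M (a n)) \<longlonglongrightarrow> I"
  proof (rule order_tendstoI)
    fix y assume "y < I"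
    then show "eventually (\<lambda>n. y < ereal (1 / real n) * ereal_integral M (a n)) sequentially"
      using I_le by (intro eventually_mono[OF eventually_ge_at_top[of "1::nat"]]) (rule less_le_trans)
  next
    fix y assume "I < y"
    with J_lim have "eventually (\<lambda>L. ereal (\<integral>x. \<psi> L x * g x \<partial>M) < y) sequentially"
      by (rule order_tendstoD(2))
    then obtain L where L: "ereal (\<integral>x. \<psi> L x * g x \<partial>M) < y" by (auto simp: eventually_sequentially)
    have "(\<lambda>n. ereal ((\<integral>x. b L n x \<partial>M) / real n)) \<longlonglongrightarrow> ereal (\<integral>x. \<psi> L x * g x \<partial>M)"
      using \<psi>_mean by simp
    then have "eventually (\<lambda>n. ereal ((\<integral>x. b L n x \<partial>M) / real n) < y) sequentially"
      using L by (rule order_tendstoD(2))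
    then show "eventually (\<lambda>n. ereal (1 / real n) * ereal_integral M (a n) < y) sequentially"
      using eventually_ge_at_top[of "1::nat"]
    proof eventually_elim
      case (elim n)
      have "ereal_integral M (a n) \<le> ereal (\<integral>x. b L n x \<partial>M)"
        unfolding b_trunc[OF elim(2)] by (rule trunc_a(2)[OF elim(2) elim(2)])
      then have "ereal (1 / real n) * ereal_integral M (a n) \<le> ereal (1 / real n) * ereal (\<integral>x. b L n x \<partial>M)"
        by (intro ereal_mult_left_mono) auto
      also have "\<dots> < y" using elim(1) by simp
      finally show ?case .
    qed
  qed
  then show ?thesis
    using h h_fin pos_a pos_hg I_le unfolding I_def by (intro bexI[of _ h]) auto
qed

end

section \<open>Restriction to an invariant set\<close>

lemma invariant_set_iterate:
  assumes "measure_preserving_map M T" "invariant_set M T A" "x \<in> space M"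
  shows "(T ^^ n) x \<in> A \<longleftrightarrow> x \<in> A"
proof (induction n)
  case (Suc n)
  interpret measure_preserving M T by unfold_locales fact
  have "(T ^^ n) x \<in> space M"
    using measurable_space[OF measurable_iterate assms(3)] .
  then have "T ((T ^^ n) x) \<in> A \<longleftrightarrow> (T ^^ n) x \<in> A"
    using assms(2) by (auto simp: invariant_set_def)
  with Suc show ?case by simp
qed simp

text \<open>This is why invariant sets need no separate treatment: cutting off with the indicator of an
invariant set stays within the class of subadditive sequences.\<close>

lemma subadditive_seq_indicator:
  assumes "measure_preserving_map M T" "subadditive_seq M T a" "invariant_set M T A"
  shows "subadditive_seq M T (\<lambda>n x. indicator A x * a n x)"
  unfolding subadditive_seq_def
proof (intro allI impI)
  fix n m :: nat assume "1 \<le> n" "1 \<le> m"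
  with assms(2) have "AE x in M. a (n + m) x \<le> a n x + a m ((T ^^ n) x)"
    by (simp add: subadditive_seq_def)
  then show "AE x in M. indicator A x * a (n + m) x
      \<le> indicator A x * a n x + indicator A ((T ^^ n) x) * a m ((T ^^ n) x)"
    using AE_space
  proof eventually_elim
    case (elim x)
    then show ?case
      using invariant_set_iterate[OF assms(1,3), of x n] by (auto simp: indicator_def)
  qed
qed

theorem theorem1p3:
  fixes M :: "'a measure" and T :: "'a \<Rightarrow> 'a"
    and a :: "nat \<Rightarrow> 'a \<Rightarrow> ereal" and g :: "'a \<Rightarrow> real"
  assumes "sigma_finite_measure M"
    and "measure_preserving_map M T"
    and "conservative_map M T"
    and "\<And>n. n \<ge> 1 \<Longrightarrow> a n \<in> borel_measurable M"
    and "subadditive_seq M T a"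
    and "pos_part_integrable M (a 1)"
    and "integrable M g"
    and "AE x in M. g x > 0"
  shows "\<exists>h \<in> borel_measurable M.
    (AE x in M. h x < \<infinity> \<and> (\<lambda>n. a n x / ereal (birkhoff_sum T g n x)) \<longlonglongrightarrow> h x) \<and>
    (\<forall>A \<in> sets M. invariant_set M T A \<longrightarrow>
       (\<forall>n\<ge>1. set_pos_part_integrable M A (a n)) \<and>
       set_pos_part_integrable M A (\<lambda>x. h x * ereal (g x)) \<and>
       (\<lambda>n. ereal (1 / real n) * ereal_set_integral M A (a n)) \<longlonglongrightarrow>
         (INF n\<in>{1..}. ereal (1 / real n) * ereal_set_integral M A (a n)) \<and>
       (INF n\<in>{1..}. ereal (1 / real n) * ereal_set_integral M A (a n)) =
         ereal_set_integral M A (\<lambda>x. h x * ereal (g x)) \<and>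
       ereal_set_integral M A (\<lambda>x. h x * ereal (g x)) < \<infinity>)"
proof -
  \<comment> \<open>Changing the weight on a null set makes it positive everywhere.\<close>
  define g' where "g' x = (if g x > 0 then g x else 1)" for x
  have [measurable]: "g \<in> borel_measurable M" using assms(7) by simp
  have [measurable]: "g' \<in> borel_measurable M" unfolding g'_def[abs_def] by measurable
  have gg': "AE x in M. g x = g' x"
    using assms(8) by eventually_elim (simp add: g'_def)
  have "integrable M g'"
    using assms(7) by (rule integrable_cong_AE_imp) (use gg' in \<open>auto simp: eq_commute\<close>)
  then interpret conservative_weighted M T g'
    using assms(2,3) by unfold_locales (auto simp: g'_def)
  have G_eq: "AE x in M. \<forall>n. birkhoff_sum T g n x = G n x"
    using AE_orbit[OF gg'] by eventually_elim (simp add: birkhoff_sum_def)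
  obtain h where [measurable]: "h \<in> borel_measurable M"
    and h: "AE x in M. h x < \<infinity> \<and> (\<lambda>n. a n x / ereal (G n x)) \<longlonglongrightarrow> h x"
    using subadditive_ratio[OF assms(4-6)] by blast
  have lim: "AE x in M. h x < \<infinity> \<and> (\<lambda>n. a n x / ereal (birkhoff_sum T g n x)) \<longlonglongrightarrow> h x"
    using h G_eq by eventually_elim simp
  have main: "(\<forall>n\<ge>1. set_pos_part_integrable M A (a n)) \<and>
       set_pos_part_integrable M A (\<lambda>x. h x * ereal (g x)) \<and>
       (\<lambda>n. ereal (1 / real n) * ereal_set_integral M A (a n)) \<longlonglongrightarrow>
         (INF n\<in>{1..}. ereal (1 / real n) * ereal_set_integral M A (a n)) \<and>
       (INF n\<in>{1..}. ereal (1 / real n) * ereal_set_integral M A (a n)) =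
         ereal_set_integral M A (\<lambda>x. h x * ereal (g x)) \<and>
       ereal_set_integral M A (\<lambda>x. h x * ereal (g x)) < \<infinity>"
    if [measurable]: "A \<in> sets M" and inv: "invariant_set M T A" for A
  proof -
    define aA where "aA n x = indicator A x * a n x" for n x
    have meas_aA: "aA n \<in> borel_measurable M" if "n \<ge> 1" for n
      unfolding aA_def[abs_def] using assms(4)[OF that] by measurable
    have sub_aA: "subadditive_seq M T aA"
      unfolding aA_def[abs_def] by (rule subadditive_seq_indicator[OF assms(2,5) inv])
    have pos_aA: "pos_part_integrable M (aA 1)"
    proof -
      have "(\<integral>\<^sup>+x. e2ennreal (max (aA 1 x) 0) \<partial>M) \<le> (\<integral>\<^sup>+x. e2ennreal (max (a 1 x) 0) \<partial>M)"
        by (intro nn_integral_mono e2ennreal_mono) (auto simp: aA_def indicator_def)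
      then show ?thesis
        using assms(6) meas_aA[of 1] by (auto simp: pos_part_integrable_def intro: order_le_less_trans)
    qed
    obtain k where [measurable]: "k \<in> borel_measurable M"
      and k_lim: "AE x in M. k x < \<infinity> \<and> (\<lambda>n. aA n x / ereal (G n x)) \<longlonglongrightarrow> k x"
      and k_a: "\<forall>n\<ge>1. pos_part_integrable M (aA n)"
      and k_pos: "pos_part_integrable M (\<lambda>x. k x * ereal (g' x))"
      and k_le: "\<forall>n\<ge>1. ereal_integral M (\<lambda>x. k x * ereal (g' x)) \<le> ereal (1 / real n) * ereal_integral M (aA n)"
      and k_mean: "(\<lambda>n. ereal (1 / real n) * ereal_integral M (aA n)) \<longlonglongrightarrow> ereal_integral M (\<lambda>x. k x * ereal (g' x))"
      using subadditive_ratio[OF meas_aA sub_aA pos_aA] by blast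
    have k_eq: "AE x in M. k x * ereal (g' x) = indicator A x * (h x * ereal (g x))"
      using h k_lim gg'
    proof eventually_elim
      case (elim x)
      have "k x = indicator A x * h x"
      proof (cases "x \<in> A")
        case True
        then show ?thesis using elim(1,2) by (auto simp: aA_def intro: LIMSEQ_unique)
      next
        case False
        then have "(\<lambda>n. 0) \<longlonglongrightarrow> k x" using elim(2) by (simp add: aA_def)
        then show ?thesis using False by (simp add: LIMSEQ_const_iff)
      qed
      then show ?case using elim(3) by (simp add: mult.assoc)
    qed
    define u where "u n = ereal (1 / real n) * ereal_set_integral M A (a n)" for n
    have u: "u n = ereal (1 / real n) * ereal_integral M (aA n)" for n
      by (simp add: u_def ereal_set_integral_def aA_def[abs_def])
    have I: "ereal_integral M (\<lambda>x. k x * ereal (g' x)) = ereal_set_integral M A (\<lambda>x. h x * ereal (g x))"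
      unfolding ereal_set_integral_def by (rule ereal_integral_cong_AE[OF k_eq])
    have u_lim: "u \<longlonglongrightarrow> ereal_set_integral M A (\<lambda>x. h x * ereal (g x))"
      using k_mean by (simp add: u[abs_def] I)
    have INF_eq: "(INF n\<in>{1..}. u n) = ereal_set_integral M A (\<lambda>x. h x * ereal (g x))"
    proof (rule antisym)
      show "(INF n\<in>{1..}. u n) \<le> ereal_set_integral M A (\<lambda>x. h x * ereal (g x))"
        by (rule LIMSEQ_le_const[OF u_lim]) (auto intro!: exI[of _ 1] INF_lower)
      show "ereal_set_integral M A (\<lambda>x. h x * ereal (g x)) \<le> (INF n\<in>{1..}. u n)"
        using k_le by (intro INF_greatest) (simp add: u I)
    qed
    have "\<forall>n\<ge>1. set_pos_part_integrable M A (a n)"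
      using k_a by (simp add: set_pos_part_integrable_def aA_def[abs_def])
    moreover have "set_pos_part_integrable M A (\<lambda>x. h x * ereal (g x))"
      unfolding set_pos_part_integrable_def
      by (rule pos_part_integrable_cong_AE[OF k_eq k_pos]) measurable
    moreover have "ereal_set_integral M A (\<lambda>x. h x * ereal (g x)) < \<infinity>"
      using ereal_integral_less_top[OF k_pos] by (simp add: I)
    ultimately show ?thesis
      using u_lim INF_eq unfolding u_def by simp
  qed
  show ?thesis
    by (intro bexI[of _ h] conjI[OF lim] ballI impI main) simp_all
qed

end
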